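(* Let $(G,u,v)$ be a rigidly marked twice-marked bridgeless graph of genus $2$ with torsion order $k$. Then $(G,u,v)$ has $k$-general transmission if and only if the class $[u-v]\in\mathrm{Jac}(G)$ is non-recurrent.
   Context: A graph is a finite, connected, loopless multigraph (parallel edges allowed); its genus is $g=|E(G)|-|V(G)|+1$; it is bridgeless if it is 2-edge-connected. A divisor on $G$ is an element of the free abelian group on $V(G)$. Linear equivalence $\sim$ is generated by chip-firing (firing $w$ subtracts $\mathrm{val}(w)$ chips from $w$ and adds to each other vertex the number of edges joining it to $w$). $|D|$ is the set of effective divisors equivalent to $D$. The rank $r(D)$ is $-1$ if $|D|=\emptyset$, else the largest $r\ge0$ such that $|D-E|\neq\emptyset$ for every effective $E$ of degree $r$. $\mathrm{Jac}(G)$ is the group of degree-$0$ divisor classes. $\delta(P)$ is $1$ if $P$ holds and $0$ otherwise. A twice-marked graph $(G,u,v)$ is a graph with two chosen vertices; its torsion order is the least $k\ge1$ with $ku\sim kv$. A twist of $D$ is $D+au+bv$, $a,b\in\mathbb Z$. $\Delta(D)=r(D)-r(D-u)-r(D-v)+r(D-u-v)$. $D$ is submodular if $\Delta(D')\ge0$ for all twists $D'$. If $D$ is submodular, its transmission permutation $\tau^{u,v}_D$ is the unique bijection $\mathbb Z\to\mathbb Z$ with $\delta(\tau^{u,v}_D(b)=a)=\Delta(D+au-bv)$ for all $a,b$. An inversion of a bijection $\tau$ is a pair $(a,b)$ with $a<b$, $\tau(a)>\tau(b)$; two inversions $(a,b),(a',b')$ are $k$-equivalent if $a-a'=b-b'\equiv0\pmod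 k$; $\mathrm{inv}_k(\tau)$ is the number of $k$-equivalence classes of inversions. A genus-$g$ twice-marked graph has $k$-general transmission if $ku\sim kv$, every divisor is submodular, and $\mathrm{inv}_k(\tau^{u,v}_D)\le g$ for every divisor $D$. $(G,u,v)$ is rigidly marked if every divisor on $G$ is submodular and $r(u+v)=0$. A degree-$0$ class $[D]\in\mathrm{Jac}(G)$ of order $k$ is non-recurrent if for every vertex $w\in V(G)$ there is at most one integer $n\in\{1,\dots,k-1\}$ with $|nD+w|\ne\emptyset$. *)

theory Defs
  imports Main "HOL-Library.Extended_Nat"
begin

text \<open>A multigraph is given by a vertex set V and an edge-multiplicity function
  m :: 'a => 'a => nat (m x y = number of edges joining x and y).\<close>

definition connected_mg :: "'a set \<Rightarrow> ('a \<Rightarrow> 'a \<Rightarrow> nat) \<Rightarrow> bool" where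
  "connected_mg V m \<longleftrightarrow> V \<noteq> {} \<and>
     (\<forall>x\<in>V. \<forall>y\<in>V. (x, y) \<in> {(a, b). 0 < m a b}\<^sup>*)"

definition is_graph :: "'a set \<Rightarrow> ('a \<Rightarrow> 'a \<Rightarrow> nat) \<Rightarrow> bool" where
  "is_graph V m \<longleftrightarrow> finite V \<and>
     (\<forall>x y. m x y = m y x) \<and>
     (\<forall>x. m x x = 0) \<and>
     (\<forall>x y. 0 < m x y \<longrightarrow> x \<in> V \<and> y \<in> V) \<and>
     connected_mg V m"

text \<open>Remove one copy of the edge {x,y}.\<close>
definition remove_edge :: "('a \<Rightarrow> 'a \<Rightarrow> nat) \<Rightarrow> 'a \<Rightarrow> 'a \<Rightarrow> ('a \<Rightarrow> 'a \<Rightarrow> nat)" where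
  "remove_edge m x y = (\<lambda>a b. if (a = x \<and> b = y) \<or> (a = y \<and> b = x) then m a b - 1 else m a b)"

definition bridgeless :: "'a set \<Rightarrow> ('a \<Rightarrow> 'a \<Rightarrow> nat) \<Rightarrow> bool" where
  "bridgeless V m \<longleftrightarrow> connected_mg V m \<and>
     (\<forall>x y. 0 < m x y \<longrightarrow> connected_mg V (remove_edge m x y))"

definition num_edges :: "'a set \<Rightarrow> ('a \<Rightarrow> 'a \<Rightarrow> nat) \<Rightarrow> nat" where
  "num_edges V m = (\<Sum>x\<in>V. \<Sum>y\<in>V. m x y) div 2"

definition genus :: "'a set \<Rightarrow> ('a \<Rightarrow> 'a \<Rightarrow> nat) \<Rightarrow> int" where
  "genus V m = int (num_edges V m) - int (card V) + 1"

text \<open>Divisors: integer functions supported on V.\<close>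
definition divisors :: "'a set \<Rightarrow> ('a \<Rightarrow> int) set" where
  "divisors V = {D. \<forall>x. x \<notin> V \<longrightarrow> D x = 0}"

definition pt :: "'a \<Rightarrow> 'a \<Rightarrow> int" where
  "pt u = (\<lambda>x. if x = u then 1 else 0)"

definition deg :: "'a set \<Rightarrow> ('a \<Rightarrow> int) \<Rightarrow> int" where
  "deg V D = (\<Sum>x\<in>V. D x)"

definition effective :: "'a set \<Rightarrow> ('a \<Rightarrow> int) \<Rightarrow> bool" where
  "effective V D \<longleftrightarrow> D \<in> divisors V \<and> (\<forall>x. 0 \<le> D x)"

text \<open>Linear equivalence: D' is obtained from D by firing each vertex x f(x) times
  (f integer valued, so that inverse firings are allowed).\<close>
definition lin_equiv :: "'a set \<Rightarrow> ('a \<Rightarrow> 'a \<Rightarrow> nat) \<Rightarrow> ('a \<Rightarrow> int) \<Rightarrow> ('a \<Rightarrow> int) \<Rightarrow> bool" where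
  "lin_equiv V m D D' \<longleftrightarrow>
     (\<exists>f :: 'a \<Rightarrow> int. \<forall>x. D' x = D x - (\<Sum>y\<in>V. int (m x y) * (f x - f y)))"

definition linsys :: "'a set \<Rightarrow> ('a \<Rightarrow> 'a \<Rightarrow> nat) \<Rightarrow> ('a \<Rightarrow> int) \<Rightarrow> ('a \<Rightarrow> int) set" where
  "linsys V m D = {E. effective V E \<and> lin_equiv V m D E}"

definition rank :: "'a set \<Rightarrow> ('a \<Rightarrow> 'a \<Rightarrow> nat) \<Rightarrow> ('a \<Rightarrow> int) \<Rightarrow> int" where
  "rank V m D = (if linsys V m D = {} then -1 else
     (GREATEST r :: int. 0 \<le> r \<and>
        (\<forall>E. effective V E \<and> deg V E = r \<longrightarrow> linsys V m (\<lambda>x. D x - E x) \<noteq> {})))"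

definition twist :: "'a \<Rightarrow> 'a \<Rightarrow> ('a \<Rightarrow> int) \<Rightarrow> int \<Rightarrow> int \<Rightarrow> ('a \<Rightarrow> int)" where
  "twist u v D a b = (\<lambda>x. D x + a * pt u x + b * pt v x)"

definition Delta :: "'a set \<Rightarrow> ('a \<Rightarrow> 'a \<Rightarrow> nat) \<Rightarrow> 'a \<Rightarrow> 'a \<Rightarrow> ('a \<Rightarrow> int) \<Rightarrow> int" where
  "Delta V m u v D = rank V m D - rank V m (twist u v D (-1) 0)
     - rank V m (twist u v D 0 (-1)) + rank V m (twist u v D (-1) (-1))"

definition submodular :: "'a set \<Rightarrow> ('a \<Rightarrow> 'a \<Rightarrow> nat) \<Rightarrow> 'a \<Rightarrow> 'a \<Rightarrow> ('a \<Rightarrow> int) \<Rightarrow> bool" where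
  "submodular V m u v D \<longleftrightarrow> (\<forall>a b. 0 \<le> Delta V m u v (twist u v D a b))"

text \<open>Transmission permutation: the unique bijection tau of Z with
  delta(tau b = a) = Delta(D + a u - b v).\<close>
definition trans_perm :: "'a set \<Rightarrow> ('a \<Rightarrow> 'a \<Rightarrow> nat) \<Rightarrow> 'a \<Rightarrow> 'a \<Rightarrow> ('a \<Rightarrow> int) \<Rightarrow> (int \<Rightarrow> int)" where
  "trans_perm V m u v D = (THE \<tau>. bij \<tau> \<and>
     (\<forall>a b. (if \<tau> b = a then 1 else 0) = Delta V m u v (twist u v D a (- b))))"

definition inversions :: "(int \<Rightarrow> int) \<Rightarrow> (int \<times> int) set" where
  "inversions \<tau> = {(a, b). a < b \<and> \<tau> a > \<tau> b}"

definition k_equiv :: "nat \<Rightarrow> (int \<times> int) set \<Rightarrow> ((int \<times> int) \<times> (int \<times> int)) set" where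
  "k_equiv k S = {((a, b), (a', b')). (a, b) \<in> S \<and> (a', b') \<in> S \<and>
      a - a' = b - b' \<and> int k dvd (a - a')}"

text \<open>Number of k-equivalence classes of inversions (infinity if infinitely many).\<close>
definition inv_k :: "nat \<Rightarrow> (int \<Rightarrow> int) \<Rightarrow> enat" where
  "inv_k k \<tau> = (let Q = inversions \<tau> // k_equiv k (inversions \<tau>) in
      if finite Q then enat (card Q) else \<infinity>)"

definition torsion_order :: "'a set \<Rightarrow> ('a \<Rightarrow> 'a \<Rightarrow> nat) \<Rightarrow> 'a \<Rightarrow> 'a \<Rightarrow> nat \<Rightarrow> bool" where
  "torsion_order V m u v k \<longleftrightarrow> 1 \<le> k \<and>
     lin_equiv V m (\<lambda>x. int k * pt u x) (\<lambda>x. int k * pt v x) \<and>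
     (\<forall>j. 1 \<le> j \<and> j < k \<longrightarrow> \<not> lin_equiv V m (\<lambda>x. int j * pt u x) (\<lambda>x. int j * pt v x))"

definition k_general_transmission ::
  "'a set \<Rightarrow> ('a \<Rightarrow> 'a \<Rightarrow> nat) \<Rightarrow> 'a \<Rightarrow> 'a \<Rightarrow> nat \<Rightarrow> bool" where
  "k_general_transmission V m u v k \<longleftrightarrow>
     lin_equiv V m (\<lambda>x. int k * pt u x) (\<lambda>x. int k * pt v x) \<and>
     (\<forall>D\<in>divisors V. submodular V m u v D) \<and>
     (\<forall>D\<in>divisors V. inv_k k (trans_perm V m u v D) \<le> enat (nat (genus V m)))"

definition rigidly_marked :: "'a set \<Rightarrow> ('a \<Rightarrow> 'a \<Rightarrow> nat) \<Rightarrow> 'a \<Rightarrow> 'a \<Rightarrow> bool" where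
  "rigidly_marked V m u v \<longleftrightarrow>
     (\<forall>D\<in>divisors V. submodular V m u v D) \<and>
     rank V m (\<lambda>x. pt u x + pt v x) = 0"

text \<open>Order of a degree-0 divisor class [D] in Jac(G).\<close>
definition class_order :: "'a set \<Rightarrow> ('a \<Rightarrow> 'a \<Rightarrow> nat) \<Rightarrow> ('a \<Rightarrow> int) \<Rightarrow> nat" where
  "class_order V m D = (LEAST k :: nat. 1 \<le> k \<and> lin_equiv V m (\<lambda>x. int k * D x) (\<lambda>x. 0))"

definition non_recurrent :: "'a set \<Rightarrow> ('a \<Rightarrow> 'a \<Rightarrow> nat) \<Rightarrow> ('a \<Rightarrow> int) \<Rightarrow> bool" where
  "non_recurrent V m D \<longleftrightarrow>
     (\<forall>w\<in>V. card {n :: nat. 1 \<le> n \<and> n < class_order V m D \<and>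
                 linsys V m (\<lambda>x. int n * D x + pt w x) \<noteq> {}} \<le> 1)"

end

theory Submission
  imports Defs
begin

text \<open>
  After a twist, \<open>D\<close> gives degree-one divisors \<open>D\<^sub>n = D + (n + 1 - deg D) u - n v\<close>, periodic in \<open>n\<close>
  modulo \<open>k\<close> up to equivalence. In genus two the rank of every divisor is determined by its degree
  and by whether it is trivial (degree 0), winnable (degree 1) or canonical (degree 2), so the
  ranks of all twists of \<open>D\<close> are encoded by the set of \<open>n\<close> with \<open>D\<^sub>n\<close> winnable, the \<open>n\<close> with
  \<open>D\<^sub>n \<sim> K - u\<close> and the \<open>n\<close> with \<open>D\<^sub>n \<sim> v\<close>. Submodularity and rigidity say that \<open>D\<^sub>n\<close> and \<open>D\<^sub>n\<^sub>+\<^sub>1\<close> are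
  both winnable exactly when one, and then only one, of the last two cases occurs. The transmission
  permutation can then be written down (it moves each integer by at most two from the shifted
  identity), and its inversions correspond bijectively to the winnable \<open>D\<^sub>n\<close>. Hence \<open>inv\<^sub>k\<close> is the
  number of winnable \<open>D\<^sub>n\<close> modulo \<open>k\<close>. If some \<open>D\<^sub>n\<close> is winnable, it is equivalent to a vertex \<open>w\<close>, and
  the remaining ones are counted by the non-recurrence condition at \<open>w\<close>. The rank facts come
  from the degree \<open>g - 2\<close>, \<open>g - 1\<close> and \<open>\<ge> g\<close> cases of Riemann--Roch, proved with acyclic
  orientations as in Baker and Norine.
\<close>

section \<open>Chip firing\<close>

locale multigraph =
  fixes V :: "'a set" and m :: "'a \<Rightarrow> 'a \<Rightarrow> nat"
  assumes is_graph: "is_graph V m"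
begin

abbreviation equivalent (infix "\<sim>" 50) where
  "D \<sim> D' \<equiv> lin_equiv V m D D'"

abbreviation winnable where
  "winnable D \<equiv> linsys V m D \<noteq> {}"

definition lap :: "('a \<Rightarrow> int) \<Rightarrow> 'a \<Rightarrow> int" where
  "lap f x = (\<Sum>y\<in>V. int (m x y) * (f x - f y))"

lemma finite_V: "finite V"
  and m_commute: "m x y = m y x"
  and m_self: "m x x = 0"
  and m_vertices: "0 < m x y \<Longrightarrow> x \<in> V \<and> y \<in> V"
  and m_connected: "x \<in> V \<Longrightarrow> y \<in> V \<Longrightarrow> (x, y) \<in> {(a, b). 0 < m a b}\<^sup>*"
  using is_graph by (auto simp: is_graph_def connected_mg_def)

lemma lin_equiv_lap: "D \<sim> D' \<longleftrightarrow> (\<exists>f. \<forall>x. D' x = D x - lap f x)"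
  by (simp add: lin_equiv_def lap_def)

lemma lap_outside: "x \<notin> V \<Longrightarrow> lap f x = 0"
  using m_vertices unfolding lap_def by (intro sum.neutral) auto

lemma lap_zero: "lap (\<lambda>x. 0) x = 0"
  by (simp add: lap_def)

lemma lap_add: "lap (\<lambda>x. f x + g x) x = lap f x + lap g x"
  unfolding lap_def sum.distrib[symmetric] by (rule sum.cong) (auto simp: algebra_simps)

lemma lap_scale: "lap (\<lambda>x. c * f x) x = c * lap f x"
  unfolding lap_def sum_distrib_left by (rule sum.cong) (auto simp: algebra_simps)

text \<open>After expansion the diagonal terms agree, and symmetry of \<open>m\<close> exchanges the
  cross terms. Taking \<open>h\<close> constant gives conservation of degree; taking
  \<open>h\<close> superharmonic measures how a firing move changes a potential.\<close>

lemma lap_self_adjoint: "(\<Sum>x\<in>V. h x * lap f x) = (\<Sum>x\<in>V. f x * lap h x)"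
proof -
  have expand: "(\<Sum>x\<in>V. h x * lap f x) =
      (\<Sum>x\<in>V. \<Sum>y\<in>V. int (m x y) * h x * f x) - (\<Sum>x\<in>V. \<Sum>y\<in>V. int (m x y) * h x * f y)" for h f
    unfolding lap_def sum_distrib_left sum_subtractf[symmetric]
    by (intro sum.cong refl) (auto simp: algebra_simps)
  have "(\<Sum>x\<in>V. \<Sum>y\<in>V. int (m x y) * h x * f y) = (\<Sum>x\<in>V. \<Sum>y\<in>V. int (m x y) * f x * h y)"
    by (subst sum.swap) (intro sum.cong refl, simp add: m_commute)
  then show ?thesis
    unfolding expand[of h f] expand[of f h] by (simp add: mult_ac)
qed

lemma sum_lap: "(\<Sum>x\<in>V. lap f x) = 0"
  using lap_self_adjoint[of "\<lambda>x. 1" f] by (simp add: lap_def)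

text \<open>Equivalence depends only on the difference of the two divisors. Most later equivalences
  are obtained this way, from known ones by pointwise algebra.\<close>

lemma lin_equiv_diff_cong:
  assumes "D \<sim> D'" and "\<And>x. A x - B x = D x - D' x"
  shows "A \<sim> B"
proof -
  obtain f where "\<forall>x. D' x = D x - lap f x"
    using assms(1) by (auto simp: lin_equiv_lap)
  then have "\<forall>x. B x = A x - lap f x"
    using assms(2) by (smt (verit))
  then show ?thesis by (auto simp: lin_equiv_lap)
qed

lemma lin_equiv_refl: "D \<sim> D"
  unfolding lin_equiv_lap by (rule exI[of _ "\<lambda>x. 0"]) (simp add: lap_zero)

lemma lin_equiv_add:
  assumes "D \<sim> D'" "E \<sim> E'" shows "(\<lambda>x. D x + E x) \<sim> (\<lambda>x. D' x + E' x)"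
proof -
  obtain f g where "\<forall>x. D' x = D x - lap f x" "\<forall>x. E' x = E x - lap g x"
    using assms by (auto simp: lin_equiv_lap)
  then show ?thesis
    unfolding lin_equiv_lap by (intro exI[of _ "\<lambda>x. f x + g x"]) (simp add: lap_add)
qed

lemma lin_equiv_scale:
  assumes "D \<sim> D'" shows "(\<lambda>x. c * D x) \<sim> (\<lambda>x. c * D' x)"
proof -
  obtain f where "D' = (\<lambda>x. D x - lap f x)"
    using assms by (auto simp: lin_equiv_lap)
  then show ?thesis
    unfolding lin_equiv_lap
    by (intro exI[of _ "\<lambda>x. c * f x"]) (simp add: lap_scale algebra_simps)
qed

lemma lin_equiv_sym: "D \<sim> D' \<Longrightarrow> D' \<sim> D"
  by (rule lin_equiv_diff_cong[OF lin_equiv_scale[of D D' "-1"]]) auto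

lemma lin_equiv_trans: "D \<sim> D' \<Longrightarrow> D' \<sim> D'' \<Longrightarrow> D \<sim> D''"
  by (rule lin_equiv_diff_cong[OF lin_equiv_add[of D D' D' D'']]) auto

lemma lin_equiv_deg: "D \<sim> D' \<Longrightarrow> deg V D' = deg V D"
  by (auto simp: lin_equiv_lap deg_def sum_subtractf sum_lap)

lemma lin_equiv_divisors: "D \<sim> D' \<Longrightarrow> D \<in> divisors V \<Longrightarrow> D' \<in> divisors V"
  by (auto simp: lin_equiv_lap divisors_def lap_outside)

section \<open>Degrees and effective divisors\<close>

lemma pt_divisor: "w \<in> V \<Longrightarrow> pt w \<in> divisors V"
  by (auto simp: pt_def divisors_def)

lemma deg_pt: "w \<in> V \<Longrightarrow> deg V (pt w) = 1"
  by (simp add: deg_def pt_def finite_V)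

lemma deg_add: "deg V (\<lambda>x. A x + B x) = deg V A + deg V B"
  by (simp add: deg_def sum.distrib)

lemma deg_diff: "deg V (\<lambda>x. A x - B x) = deg V A - deg V B"
  by (simp add: deg_def sum_subtractf)

lemma deg_scale: "deg V (\<lambda>x. c * A x) = c * deg V A"
  by (simp add: deg_def sum_distrib_left)

lemma divisors_add: "A \<in> divisors V \<Longrightarrow> B \<in> divisors V \<Longrightarrow> (\<lambda>x. A x + B x) \<in> divisors V"
  and divisors_diff: "A \<in> divisors V \<Longrightarrow> B \<in> divisors V \<Longrightarrow> (\<lambda>x. A x - B x) \<in> divisors V"
  and divisors_scale: "A \<in> divisors V \<Longrightarrow> (\<lambda>x. c * A x) \<in> divisors V"
  by (auto simp: divisors_def)

lemmas deg_simps = deg_add deg_diff deg_scale deg_pt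
lemmas divisors_intros = divisors_add divisors_diff divisors_scale pt_divisor

lemma effective_divisor: "effective V D \<Longrightarrow> D \<in> divisors V"
  by (simp add: effective_def)

lemma effective_deg: "effective V D \<Longrightarrow> 0 \<le> deg V D"
  by (auto simp: effective_def deg_def intro: sum_nonneg)

lemma effective_deg_0: "effective V D \<Longrightarrow> deg V D = 0 \<Longrightarrow> D = (\<lambda>x. 0)"
  by (rule ext) (auto simp: effective_def deg_def divisors_def sum_nonneg_eq_0_iff finite_V)

lemma effective_pt: "w \<in> V \<Longrightarrow> effective V (pt w)"
  by (auto simp: effective_def pt_def divisors_def)

lemma effective_add: "effective V D \<Longrightarrow> effective V E \<Longrightarrow> effective V (\<lambda>x. D x + E x)"
  by (auto simp: effective_def divisors_def)

lemma effective_scale: "effective V D \<Longrightarrow> 0 \<le> c \<Longrightarrow> effective V (\<lambda>x. c * D x)"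
  by (auto simp: effective_def divisors_def)

lemma effective_deg_1:
  assumes "effective V D" "deg V D = 1"
  obtains w where "w \<in> V" "D = pt w"
proof -
  have "\<exists>w\<in>V. D w \<noteq> 0"
    using assms(2) by (auto simp: deg_def intro: ccontr dest: sum.not_neutral_contains_not_neutral)
  then obtain w where w: "w \<in> V" "D w \<ge> 1"
    using assms(1) by (smt (verit) effective_def)
  have "effective V (\<lambda>x. D x - pt w x)"
    using assms(1) w by (auto simp: effective_def pt_def divisors_def)
  then have "(\<lambda>x. D x - pt w x) = (\<lambda>x. 0)"
    using assms(2) w by (intro effective_deg_0) (auto simp: deg_simps)
  then have "D = pt w"
    by (metis (no_types, lifting) ext right_minus_eq)
  with w show ?thesis using that by blast
qed

section \<open>Winnable divisors, with degrees 0 and 1 made explicit\<close>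

lemma winnable_iff: "winnable D \<longleftrightarrow> (\<exists>E. effective V E \<and> D \<sim> E)"
  by (auto simp: linsys_def)

lemma winnable_cong: "D \<sim> D' \<Longrightarrow> winnable D \<longleftrightarrow> winnable D'"
  unfolding winnable_iff by (meson lin_equiv_sym lin_equiv_trans)

lemma winnable_effective: "effective V D \<Longrightarrow> winnable D"
  unfolding winnable_iff using lin_equiv_refl by blast

lemma winnable_add: 
  assumes "winnable D" "winnable E" shows "winnable (\<lambda>x. D x + E x)"
  using assms effective_add lin_equiv_add unfolding winnable_iff by meson

lemma winnable_deg: "winnable D \<Longrightarrow> 0 \<le> deg V D"
  unfolding winnable_iff using effective_deg lin_equiv_deg by metis

lemma winnable_deg_0:
  assumes "deg V D = 0" shows "winnable D \<longleftrightarrow> D \<sim> (\<lambda>x. 0)"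
proof
  assume "winnable D"
  then show "D \<sim> (\<lambda>x. 0)"
    unfolding winnable_iff using effective_deg_0 lin_equiv_deg assms by metis
next
  assume "D \<sim> (\<lambda>x. 0)"
  then show "winnable D"
    unfolding winnable_iff by (auto simp: effective_def divisors_def)
qed

lemma winnable_deg_1:
  assumes "deg V D = 1" shows "winnable D \<longleftrightarrow> (\<exists>w\<in>V. D \<sim> pt w)"
  unfolding winnable_iff using effective_deg_1 lin_equiv_deg effective_pt assms by metis

section \<open>Reduced divisors and acyclic orientations\<close>

text \<open>A concave function of the distance to \<open>q\<close> that decays fast enough is superharmonic off \<open>q\<close>.\<close>

lemma exists_superharmonic_potential:
  assumes "q \<in> V"
  obtains h where "h q = 0" "\<And>x. 0 \<le> h x" "\<And>x. x \<in> V \<Longrightarrow> x \<noteq> q \<Longrightarrow> 1 \<le> lap h x"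
proof -
  define R where "R = {(a, b). 0 < m a b}"
  define d where "d x = (LEAST n. (q, x) \<in> R ^^ n)" for x
  \<comment> \<open>\<open>M\<close> exceeds the number of edge ends at any vertex, and the
    increments of \<open>H\<close> shrink by the factor \<open>M\<close> per unit of distance. With
    \<open>?P\<close> as below, an edge towards \<open>q\<close> therefore contributes at least
    \<open>M * ?P\<close>, while all other edges together cost at most
    \<open>(M - 1) * ?P\<close>.\<close>
  define M where "M = 1 + (\<Sum>x\<in>V. \<Sum>y\<in>V. int (m x y))"
  define N where "N = Max (d ` V)"
  define H where "H n = (\<Sum>j<n. M ^ (N - j))" for n
  have M_pos: "1 \<le> M" by (simp add: M_def sum_nonneg)
  have reach: "(q, x) \<in> R ^^ d x" if x: "x \<in> V" for x
  proof -
    obtain n where "(q, x) \<in> R ^^ n"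
      using m_connected[OF assms x] by (auto simp: R_def dest: rtrancl_imp_relpow)
    then show ?thesis unfolding d_def by (rule LeastI)
  qed
  have d_le: "d x \<le> n" if "(q, x) \<in> R ^^ n" for x n
    unfolding d_def using that by (rule Least_le)
  have d_step: "d y \<le> Suc (d x)" if "0 < m x y" for x y
  proof -
    have "(q, x) \<in> R ^^ d x" using reach that m_vertices by blast
    then have "(q, y) \<in> R ^^ Suc (d x)" using that by (auto simp: R_def)
    then show ?thesis by (rule d_le)
  qed
  have H_mono: "H i \<le> H j" if "i \<le> j" for i j
    unfolding H_def using that M_pos by (intro sum_mono2) auto
  have "1 \<le> lap (\<lambda>x. H (d x)) x" if x: "x \<in> V" "x \<noteq> q" for x
  proof -
    have "d x \<noteq> 0" using reach[OF x(1)] x(2) by (metis relpow_0_E)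
    then obtain e where e: "d x = Suc e" by (cases "d x") auto
    then obtain z where z: "(q, z) \<in> R ^^ e" "0 < m z x"
      using reach[OF x(1)] by (auto simp: R_def)
    have zV: "z \<in> V" "0 < m x z" using z m_vertices m_commute by metis+
    have "Suc e \<le> N" unfolding N_def e[symmetric] using x finite_V by simp
    then have Ne: "M ^ (N - e) = M * M ^ (N - Suc e)"
      by (metis Suc_diff_le diff_Suc_Suc power_Suc)
    let ?P = "M ^ (N - Suc e)"
    have P: "1 \<le> ?P" using M_pos by simp
    have near: "H (d x) - H (d y) \<ge> - ?P" if "0 < m x y" for y
    proof -
      have "H (d y) \<le> H (Suc (Suc e))" using d_step[OF that] e by (intro H_mono) simp
      also have "\<dots> = H (d x) + ?P" by (simp add: e H_def)
      finally show ?thesis by simp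
    qed
    have "H (d z) \<le> H e" using d_le[OF z(1)] by (rule H_mono)
    then have far: "H (d x) - H (d z) \<ge> M * ?P" by (simp add: e H_def Ne)
    have "int (m x z) * (H (d x) - H (d z)) \<ge> int (m x z) * (M * ?P)"
      using far by (intro mult_left_mono) auto
    moreover have "int (m x z) * (M * ?P) \<ge> 1 * (M * ?P)"
      using zV M_pos P by (intro mult_right_mono) auto
    moreover have "(\<Sum>y\<in>V - {z}. int (m x y) * (H (d x) - H (d y)))
        \<ge> (\<Sum>y\<in>V - {z}. int (m x y) * - ?P)"
    proof (rule sum_mono)
      fix y
      show "int (m x y) * - ?P \<le> int (m x y) * (H (d x) - H (d y))"
        using near[of y] by (cases "m x y = 0") (auto simp del: mult_minus_right intro!: mult_left_mono)
    qed
    moreover have "(\<Sum>y\<in>V - {z}. int (m x y) * - ?P) \<ge> - (M - 1) * ?P"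
    proof -
      have "(\<Sum>y\<in>V - {z}. int (m x y)) \<le> (\<Sum>y\<in>V. int (m x y))"
        using finite_V by (intro sum_mono2) auto
      also have "\<dots> \<le> (\<Sum>x\<in>V. \<Sum>y\<in>V. int (m x y))"
        using x(1) finite_V by (intro member_le_sum) (auto intro: sum_nonneg)
      finally have "(\<Sum>y\<in>V - {z}. int (m x y)) * ?P \<le> (M - 1) * ?P"
        using P by (intro mult_right_mono) (auto simp: M_def)
      then show ?thesis by (simp add: sum_distrib_left sum_negf algebra_simps)
    qed
    moreover have "lap (\<lambda>x. H (d x)) x = int (m x z) * (H (d x) - H (d z))
        + (\<Sum>y\<in>V - {z}. int (m x y) * (H (d x) - H (d y)))"
      unfolding lap_def using finite_V zV by (simp add: sum.remove)
    moreover have "M * ?P - (M - 1) * ?P = ?P" by (simp add: algebra_simps)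
    ultimately show ?thesis using P by linarith
  qed
  moreover have "d q = 0" using d_le[of q 0] by simp
  then have "H (d q) = 0" by (simp add: H_def)
  moreover have "0 \<le> H (d x)" for x
    unfolding H_def using M_pos by (intro sum_nonneg) auto
  ultimately show ?thesis using that[of "\<lambda>x. H (d x)"] by blast
qed

text \<open>Among the equivalent divisors without debt off \<open>q\<close>, take one minimizing the
  potential weighted by \<open>h\<close>. Firing a set \<open>A\<close> that avoids \<open>q\<close>
  lowers this potential, since \<open>h\<close> is superharmonic there; by minimality some vertex of
  \<open>A\<close> cannot afford the move.\<close>

lemma exists_reduced_divisor:
  assumes "q \<in> V" and D: "D \<in> divisors V"
  obtains D' where "D \<sim> D'" "\<And>x. x \<noteq> q \<Longrightarrow> 0 \<le> D' x"
    "\<And>A. A \<subseteq> V - {q} \<Longrightarrow> A \<noteq> {} \<Longrightarrow> \<exists>x\<in>A. D' x < (\<Sum>y\<in>V - A. int (m x y))"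
proof -
  obtain h where h: "h q = 0" "\<And>x. 0 \<le> h x" "\<And>x. x \<in> V \<Longrightarrow> x \<noteq> q \<Longrightarrow> 1 \<le> lap h x"
    using exists_superharmonic_potential[OF assms(1)] by blast
  define C where "C D' \<longleftrightarrow> D \<sim> D' \<and> (\<forall>x. x \<noteq> q \<longrightarrow> 0 \<le> D' x)" for D'
  define t where "t = (\<Sum>x\<in>V. \<bar>D x\<bar>)"
  \<comment> \<open>The class \<open>C\<close> is inhabited: \<open>t\<close> bounds every debt of
    \<open>D\<close> and \<open>lap h\<close> is at least 1 off \<open>q\<close>, so firing
    according to \<open>- t * h\<close> leaves debt at most at \<open>q\<close>.\<close>
  have "C (\<lambda>x. D x + t * lap h x)"
    unfolding C_def
  proof (intro conjI allI impI)
    show "D \<sim> (\<lambda>x. D x + t * lap h x)"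
      unfolding lin_equiv_lap
      by (intro exI[of _ "\<lambda>x. (- t) * h x"]) (simp only: lap_scale, simp)
    fix x assume "x \<noteq> q"
    show "0 \<le> D x + t * lap h x"
    proof (cases "x \<in> V")
      case True
      have "\<bar>D x\<bar> \<le> t" unfolding t_def using True finite_V by (intro member_le_sum) auto
      moreover have "t * 1 \<le> t * lap h x"
        using h(3)[OF True \<open>x \<noteq> q\<close>] by (intro mult_left_mono) (auto simp: t_def sum_nonneg)
      ultimately show ?thesis by linarith
    next
      case False
      then show ?thesis using D by (simp add: lap_outside divisors_def)
    qed
  qed
  then obtain D' where CD': "C D'"
    and least: "\<And>D''. C D'' \<Longrightarrow> nat (\<Sum>x\<in>V. h x * D' x) \<le> nat (\<Sum>x\<in>V. h x * D'' x)"
    using ex_has_least_nat[of C _ "\<lambda>D'. nat (\<Sum>x\<in>V. h x * D' x)"] by blast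
  have pot_nonneg: "0 \<le> (\<Sum>x\<in>V. h x * D'' x)" if "C D''" for D''
  proof (rule sum_nonneg)
    fix x show "0 \<le> h x * D'' x"
      using that h(1) h(2)[of x] by (cases "x = q") (auto simp: C_def)
  qed
  have "\<exists>x\<in>A. D' x < (\<Sum>y\<in>V - A. int (m x y))" if A: "A \<subseteq> V - {q}" "A \<noteq> {}" for A
  proof (rule ccontr)
    assume "\<not> ?thesis"
    then have legal: "(\<Sum>y\<in>V - A. int (m x y)) \<le> D' x" if "x \<in> A" for x
      using that by (simp add: not_less)
    \<comment> \<open>The move that fires each vertex of \<open>A\<close> once: a vertex of
      \<open>A\<close> loses exactly its edges leaving \<open>A\<close>, and the other vertices lose
      nothing.\<close>
    define f where "f x = (if x \<in> A then 1 else 0 :: int)" for x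
    define D'' where "D'' x = D' x - lap f x" for x
    have "D' \<sim> D''" by (auto simp: lin_equiv_lap D''_def)
    then have "D \<sim> D''" using CD' lin_equiv_trans by (auto simp: C_def)
    moreover have "0 \<le> D'' x" if "x \<noteq> q" for x
    proof (cases "x \<in> A")
      case True
      have "lap f x = (\<Sum>y\<in>V - A. int (m x y))"
        unfolding lap_def using finite_V True
        by (intro sum.mono_neutral_cong_right) (auto simp: f_def)
      then show ?thesis using legal[OF True] by (simp add: D''_def)
    next
      case False
      then have "lap f x \<le> 0" unfolding lap_def by (intro sum_nonpos) (auto simp: f_def)
      then show ?thesis using CD' that by (fastforce simp: D''_def C_def)
    qed
    ultimately have CD'': "C D''" by (auto simp: C_def)
    have "(\<Sum>x\<in>V. h x * lap f x) = (\<Sum>x\<in>V. f x * lap h x)" by (rule lap_self_adjoint)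
    also have "\<dots> = (\<Sum>x\<in>A. lap h x)"
      using A finite_V by (intro sum.mono_neutral_cong_right) (auto simp: f_def)
    also have "\<dots> > 0"
    proof (rule sum_pos)
      show "finite A" using A finite_V finite_subset by blast
      show "0 < lap h x" if "x \<in> A" for x using A h(3)[of x] that by fastforce
    qed fact
    finally have "(\<Sum>x\<in>V. h x * D'' x) < (\<Sum>x\<in>V. h x * D' x)"
      by (simp add: D''_def algebra_simps sum_subtractf)
    with least[OF CD''] pot_nonneg[OF CD''] show False by simp
  qed
  then show ?thesis using that CD' unfolding C_def by blast
qed

text \<open>The divisor \<open>indegree - 1\<close> of the acyclic orientation in which edges point to larger \<open>p\<close>.\<close>

definition orient_div :: "('a \<Rightarrow> int) \<Rightarrow> 'a \<Rightarrow> int" where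
  "orient_div p x = (if x \<in> V then (\<Sum>y\<in>{y \<in> V. p y < p x}. int (m x y)) - 1 else 0)"

definition canonical :: "'a \<Rightarrow> int" where
  "canonical x = (if x \<in> V then (\<Sum>y\<in>V. int (m x y)) - 2 else 0)"

lemma orient_div_divisor: "orient_div p \<in> divisors V"
  and canonical_divisor: "canonical \<in> divisors V"
  by (auto simp: orient_div_def canonical_def divisors_def)

lemma V_nonempty: "V \<noteq> {}"
  using is_graph by (simp add: is_graph_def connected_mg_def)

text \<open>Suppose that firing by \<open>f\<close> clears all debt. Among the vertices where
  \<open>f\<close> is maximal, take the one with least \<open>p\<close>. All its in-neighbours have
  smaller \<open>f\<close>, so it loses at least its indegree, one chip more than it owns.\<close>

lemma orient_div_not_winnable:
  assumes "inj_on p V" shows "\<not> winnable (orient_div p)"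
proof
  assume "winnable (orient_div p)"
  then obtain f where f: "\<And>x. 0 \<le> orient_div p x - lap f x"
    by (auto simp: winnable_iff effective_def lin_equiv_lap) metis
  define T where "T = {x \<in> V. f x = Max (f ` V)}"
  have fmax: "f y \<le> Max (f ` V)" if "y \<in> V" for y using that finite_V by simp
  have "Max (f ` V) \<in> f ` V" using V_nonempty finite_V by (intro Max_in) auto
  then have "finite T" "T \<noteq> {}" using finite_V by (auto simp: T_def)
  then have "Min (p ` T) \<in> p ` T" by simp
  then obtain x where x: "x \<in> T" and "p x = Min (p ` T)" by auto
  then have min: "p x \<le> p y" if "y \<in> T" for y using \<open>finite T\<close> that by simp
  from x have xV: "x \<in> V" and fx: "f x = Max (f ` V)" by (auto simp: T_def)
  let ?B = "{y \<in> V. p y < p x}"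
  have "(\<Sum>y\<in>?B. int (m x y)) \<le> (\<Sum>y\<in>?B. int (m x y) * (f x - f y))"
  proof (rule sum_mono)
    fix y assume y: "y \<in> ?B"
    then have "y \<notin> T" using min by fastforce
    then have "f y < f x" using y fmax[of y] fx by (auto simp: T_def)
    then have "int (m x y) * 1 \<le> int (m x y) * (f x - f y)" by (intro mult_left_mono) auto
    then show "int (m x y) \<le> int (m x y) * (f x - f y)" by simp
  qed
  also have "\<dots> \<le> lap f x"
    unfolding lap_def using finite_V fmax fx by (intro sum_mono2) auto
  finally have "orient_div p x - lap f x < 0" using xV by (simp add: orient_div_def)
  with f[of x] show False by simp
qed

text \<open>Dhar's burning algorithm: the order in which the fire started at \<open>q\<close> consumes
  the vertices of a \<open>q\<close>-reduced divisor orients the graph.\<close>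

lemma winnable_or_orient_div:
  assumes D: "D \<in> divisors V" and "\<not> winnable D"
  obtains p where "inj_on p V" "winnable (\<lambda>x. orient_div p x - D x)"
proof -
  obtain q where q: "q \<in> V" using V_nonempty by blast
  obtain D' where D': "D \<sim> D'" "\<And>x. x \<noteq> q \<Longrightarrow> 0 \<le> D' x"
    "\<And>A. A \<subseteq> V - {q} \<Longrightarrow> A \<noteq> {} \<Longrightarrow> \<exists>x\<in>A. D' x < (\<Sum>y\<in>V - A. int (m x y))"
    using exists_reduced_divisor[OF q D] by blast
  \<comment> \<open>\<open>B\<close> is the burnt set after \<open>n\<close> steps and
    \<open>p\<close> the time of burning. A vertex other than \<open>q\<close> burns once its edges
    to burnt vertices outnumber its chips; the fire never stalls, because reducedness applies to the
    unburnt set.\<close>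
  have burn: "\<exists>B p. q \<in> B \<and> B \<subseteq> V \<and> card B = Suc n \<and> inj_on p B \<and> (\<forall>x\<in>B. p x \<le> int n) \<and>
      (\<forall>x\<in>B - {q}. D' x < (\<Sum>y\<in>{y \<in> B. p y < p x}. int (m x y)))" if "Suc n \<le> card V" for n
    using that
  proof (induction n)
    case 0
    show ?case by (rule exI[of _ "{q}"], rule exI[of _ "\<lambda>_. 0"]) (use q in auto)
  next
    case (Suc n)
    then obtain B p where B: "q \<in> B" "B \<subseteq> V" "card B = Suc n" "inj_on p B"
      "\<forall>x\<in>B. p x \<le> int n" "\<forall>x\<in>B - {q}. D' x < (\<Sum>y\<in>{y \<in> B. p y < p x}. int (m x y))"
      by auto
    have finB: "finite B" using B(2) finite_V finite_subset by blast
    have "V - B \<noteq> {}" using B(2,3) Suc.prems by auto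
    then obtain x where x: "x \<in> V - B" "D' x < (\<Sum>y\<in>V - (V - B). int (m x y))"
      using D'(3)[of "V - B"] B(1) by blast
    define p' where "p' = p(x := int (Suc n))"
    have p'x: "p' x = int (Suc n)" by (simp add: p'_def)
    have p'B: "p' y = p y" if "y \<in> B" for y using x(1) that by (auto simp: p'_def)
    have below_x: "{y \<in> insert x B. p' y < p' x} = B" using B(5) p'x p'B by fastforce
    have below_B: "{y \<in> insert x B. p' y < p' z} = {y \<in> B. p y < p z}" if "z \<in> B" for z
      using B(5) that p'x p'B by fastforce
    have "x \<noteq> q" "V - (V - B) = B" using B(1,2) x(1) by auto
    then have "D' z < (\<Sum>y\<in>{y \<in> insert x B. p' y < p' z}. int (m z y))"
      if "z \<in> insert x B - {q}" for z
      using that x(2) B(6) below_x below_B by (cases "z = x") auto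
    moreover have "inj_on p' (insert x B)"
    proof -
      have "inj_on p' B" using B(4) p'B by (simp add: inj_on_def)
      moreover have "p' x \<notin> p' ` B" using B(5) p'x p'B by fastforce
      ultimately show ?thesis using x(1) by (simp add: inj_on_insert)
    qed
    moreover have "p' z \<le> int (Suc n)" if "z \<in> insert x B" for z
      using B(5) that p'x p'B by fastforce
    moreover have "card (insert x B) = Suc (Suc n)" using x(1) finB B(3) by simp
    ultimately show ?case
      using B(1,2) x(1) by (intro exI[of _ "insert x B"] exI[of _ p']) auto
  qed
  have "card V \<noteq> 0" using V_nonempty finite_V by simp
  then obtain n where n: "card V = Suc n" by (cases "card V") auto
  obtain B and p :: "'a \<Rightarrow> int" where B: "B \<subseteq> V" "card B = Suc n" "inj_on p B"
      "\<forall>x\<in>B - {q}. D' x < (\<Sum>y\<in>{y \<in> B. p y < p x}. int (m x y))"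
    using burn[of n] n by auto
  then have BV: "B = V" using n finite_V card_subset_eq by metis
  have D'div: "D' \<in> divisors V" using lin_equiv_divisors D'(1) D by blast
  have "D' q < 0"
  proof (rule ccontr)
    assume "\<not> D' q < 0"
    then have "0 \<le> D' x" for x using D'(2)[of x] by (cases "x = q") auto
    then have "effective V D'" using D'div by (simp add: effective_def)
    then show False using assms(2) D'(1) by (auto simp: winnable_iff)
  qed
  \<comment> \<open>Off \<open>q\<close> the burning condition says that \<open>D' x\<close> is at
    most the indegree minus one; at \<open>q\<close> the value of \<open>orient_div p\<close> is at
    least -1, and \<open>D'\<close> is in debt.\<close>
  have "0 \<le> orient_div p x - D' x" for x
  proof -
    consider "x \<notin> V" | "x = q" | "x \<in> B - {q}" using BV by blast
    then show ?thesis
    proof cases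
      case 1
      then show ?thesis using D'div orient_div_divisor[of p] by (simp add: divisors_def)
    next
      case 2
      have "0 \<le> (\<Sum>y\<in>{y \<in> V. p y < p x}. int (m x y))" by (intro sum_nonneg) simp
      then show ?thesis using 2 q \<open>D' q < 0\<close> by (simp add: orient_div_def)
    next
      case 3
      then show ?thesis using B(4) BV by (fastforce simp: orient_div_def)
    qed
  qed
  then have "effective V (\<lambda>x. orient_div p x - D' x)"
    using divisors_diff[OF orient_div_divisor D'div] by (simp add: effective_def)
  then have "winnable (\<lambda>x. orient_div p x - D' x)" by (rule winnable_effective)
  moreover have "(\<lambda>x. orient_div p x - D' x) \<sim> (\<lambda>x. orient_div p x - D x)"
    by (rule lin_equiv_diff_cong[OF D'(1)]) simp
  ultimately show ?thesis using that B(3) BV winnable_cong by blast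
qed

text \<open>Negating \<open>p\<close> reverses every edge, and the two indegrees of a vertex add up
  to its valence. Injectivity of \<open>p\<close> ensures that each edge is oriented.\<close>

lemma canonical_minus_orient_div:
  assumes "inj_on p V"
  shows "(\<lambda>x. canonical x - orient_div p x) = orient_div (\<lambda>x. - p x)"
proof
  fix x
  show "canonical x - orient_div p x = orient_div (\<lambda>x. - p x) x"
  proof (cases "x \<in> V")
    case True
    have "V = {y \<in> V. p y < p x} \<union> {y \<in> V. p x < p y} \<union> {x}"
      using assms True by (auto simp: inj_on_def) (metis linorder_less_linear)
    then have "(\<Sum>y\<in>V. int (m x y)) = (\<Sum>y\<in>{y \<in> V. p y < p x} \<union> {y \<in> V. p x < p y} \<union> {x}. int (m x y))"
      by simp
    also have "\<dots> = (\<Sum>y\<in>{y \<in> V. p y < p x}. int (m x y)) + (\<Sum>y\<in>{y \<in> V. p x < p y}. int (m x y))"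
      using finite_V by (subst sum.union_disjoint; auto simp: m_self)+
    finally show ?thesis using True by (simp add: canonical_def orient_div_def)
  qed (simp add: canonical_def orient_div_def)
qed

text \<open>An orientation and its reverse have the same total indegree, and together they count
  every edge twice; so the total indegree is the number of edges.\<close>

lemma deg_orient_div:
  assumes "inj_on p V" shows "deg V (orient_div p) = genus V m - 1"
proof -
  let ?I = "\<lambda>p. \<Sum>x\<in>V. \<Sum>y\<in>{y \<in> V. p y < p x}. int (m x y)"
  have I: "?I p = (\<Sum>x\<in>V. \<Sum>y\<in>V. if p y < p x then int (m x y) else 0)" for p :: "'a \<Rightarrow> int"
    using finite_V by (intro sum.cong[OF refl]) (simp add: sum.inter_filter)
  have "?I (\<lambda>x. - p x) = (\<Sum>x\<in>V. \<Sum>y\<in>V. if p x < p y then int (m x y) else 0)"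
    unfolding I by simp
  also have "\<dots> = (\<Sum>x\<in>V. \<Sum>y\<in>V. if p y < p x then int (m x y) else 0)"
    by (subst sum.swap) (intro sum.cong refl, simp add: m_commute)
  also have "\<dots> = ?I p" unfolding I ..
  finally have sym: "?I (\<lambda>x. - p x) = ?I p" .
  have deg_I: "deg V (orient_div p) = ?I p - int (card V)" for p
    by (simp add: deg_def orient_div_def sum_subtractf)
  have "deg V canonical = deg V (orient_div p) + deg V (orient_div (\<lambda>x. - p x))"
    using deg_diff[of canonical "orient_div p"] canonical_minus_orient_div[OF assms] by simp
  also have "\<dots> = 2 * ?I p - 2 * int (card V)" by (simp add: deg_I sym del: neg_less_iff_less)
  moreover have "deg V canonical = (\<Sum>x\<in>V. \<Sum>y\<in>V. int (m x y)) - 2 * int (card V)"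
    by (simp add: deg_def canonical_def sum_subtractf)
  ultimately have "int (\<Sum>x\<in>V. \<Sum>y\<in>V. m x y) = 2 * ?I p" by simp
  then have "int (num_edges V m) = ?I p" by (simp add: num_edges_def zdiv_int)
  then show ?thesis by (simp add: deg_I genus_def)
qed

section \<open>The cases of Riemann--Roch that are needed\<close>

lemma exists_inj_int: "\<exists>p :: 'a \<Rightarrow> int. inj_on p V"
  using finite_imp_inj_to_nat_seg[OF finite_V] inj_of_nat
  by (metis comp_inj_on inj_on_subset top_greatest)

lemma deg_canonical: "deg V canonical = 2 * genus V m - 2"
proof -
  obtain p :: "'a \<Rightarrow> int" where p: "inj_on p V" using exists_inj_int by blast
  then have p': "inj_on (\<lambda>x. - p x) V" by (auto simp: inj_on_def)
  have "deg V canonical - deg V (orient_div p) = deg V (orient_div (\<lambda>x. - p x))"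
    using canonical_minus_orient_div[OF p] by (metis deg_diff)
  then show ?thesis using deg_orient_div p p' by simp
qed

text \<open>Otherwise some \<open>orient_div p - D\<close> would be winnable of negative
  degree.\<close>

lemma winnable_if_deg_ge_genus:
  assumes "D \<in> divisors V" "genus V m \<le> deg V D" shows "winnable D"
proof (rule ccontr)
  assume "\<not> winnable D"
  then obtain p where "inj_on p V" "winnable (\<lambda>x. orient_div p x - D x)"
    using winnable_or_orient_div assms(1) by blast
  then show False using winnable_deg[of "\<lambda>x. orient_div p x - D x"] assms(2)
    by (simp add: deg_diff deg_orient_div)
qed

text \<open>In this degree an unwinnable \<open>D\<close> is equivalent to some
  \<open>orient_div p\<close>. Its residual is then equivalent to the divisor of the reversed
  orientation, which is unwinnable too.\<close>

lemma winnable_residual: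
  assumes "D \<in> divisors V" "deg V D = genus V m - 1"
    and "winnable (\<lambda>x. canonical x - D x)"
  shows "winnable D"
proof (rule ccontr)
  assume "\<not> winnable D"
  then obtain p where p: "inj_on p V" "winnable (\<lambda>x. orient_div p x - D x)"
    using winnable_or_orient_div assms(1) by blast
  then have "(\<lambda>x. orient_div p x - D x) \<sim> (\<lambda>x. 0)"
    using assms(2) by (subst (asm) winnable_deg_0) (auto simp: deg_diff deg_orient_div)
  then have "(\<lambda>x. canonical x - D x) \<sim> (\<lambda>x. canonical x - orient_div p x)"
    by (rule lin_equiv_diff_cong) simp
  then have "winnable (orient_div (\<lambda>x. - p x))"
    using assms(3) winnable_cong canonical_minus_orient_div[OF p(1)] by metis
  moreover have "inj_on (\<lambda>x. - p x) V" using p(1) by (auto simp: inj_on_def)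
  ultimately show False using orient_div_not_winnable by blast
qed

text \<open>If \<open>D\<close> is unwinnable, some \<open>orient_div p - D\<close> is winnable of
  degree one, hence equivalent to a vertex \<open>w\<close>; then \<open>D + w\<close> is equivalent
  to the unwinnable \<open>orient_div p\<close>.\<close>

lemma winnable_if_translates_winnable:
  assumes "D \<in> divisors V" "deg V D = genus V m - 2"
    and "\<And>w. w \<in> V \<Longrightarrow> winnable (\<lambda>x. D x + pt w x)"
  shows "winnable D"
proof (rule ccontr)
  assume "\<not> winnable D"
  then obtain p where p: "inj_on p V" "winnable (\<lambda>x. orient_div p x - D x)"
    using winnable_or_orient_div assms(1) by blast
  then obtain w where w: "w \<in> V" "(\<lambda>x. orient_div p x - D x) \<sim> pt w"
    using assms(2) by (subst (asm) winnable_deg_1) (auto simp: deg_diff deg_orient_div)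
  then have "orient_div p \<sim> (\<lambda>x. D x + pt w x)"
    by (intro lin_equiv_diff_cong[OF w(2)]) simp
  then show False
    using assms(3)[OF w(1)] winnable_cong orient_div_not_winnable[OF p(1)] by blast
qed


section \<open>Rank\<close>

definition dominates where
  "dominates D r \<longleftrightarrow> (\<forall>E. effective V E \<and> deg V E = r \<longrightarrow> winnable (\<lambda>x. D x - E x))"

lemma dominatesD:
  "dominates D r \<Longrightarrow> effective V E \<Longrightarrow> deg V E = r \<Longrightarrow> winnable (\<lambda>x. D x - E x)"
  by (auto simp: dominates_def)

lemma dominates_antimono:
  assumes "dominates D s" "0 \<le> t" "t \<le> s" shows "dominates D t"
  unfolding dominates_def
proof (intro allI impI)
  fix E assume E: "effective V E \<and> deg V E = t"
  obtain q where q: "q \<in> V" using V_nonempty by blast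
  \<comment> \<open>Padding \<open>E\<close> with copies of one vertex raises its degree to
    \<open>s\<close>; the padding is effective, so giving it back preserves winnability.\<close>
  define F where "F x = (s - t) * pt q x" for x
  have F: "effective V F" "deg V F = s - t"
    unfolding F_def using q assms(3) by (auto intro: effective_scale effective_pt simp: deg_simps)
  then have "winnable (\<lambda>x. D x - (E x + F x))"
    using E effective_add deg_add[of E F] by (intro dominatesD[OF assms(1)]) auto
  then have "winnable (\<lambda>x. D x - (E x + F x) + F x)"
    using winnable_add winnable_effective F(1) by blast
  then show "winnable (\<lambda>x. D x - E x)" by simp
qed

lemma dominates_le_deg:
  assumes "dominates D s" "0 \<le> s" shows "s \<le> deg V D"
proof -
  obtain q where q: "q \<in> V" using V_nonempty by blast
  have "winnable (\<lambda>x. D x - s * pt q x)"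
    using assms(2) q
    by (intro dominatesD[OF assms(1)]) (auto intro: effective_scale effective_pt simp: deg_simps)
  from winnable_deg[OF this] show ?thesis using q by (simp add: deg_simps)
qed

lemma dominates_0: "dominates D 0 \<longleftrightarrow> winnable D"
proof
  assume "dominates D 0"
  moreover have "effective V (\<lambda>x. 0)" "deg V (\<lambda>x. 0) = 0"
    by (auto simp: effective_def divisors_def deg_def)
  ultimately have "winnable (\<lambda>x. D x - 0)" by (rule dominatesD)
  then show "winnable D" by simp
next
  assume "winnable D"
  then show "dominates D 0" by (auto simp: dominates_def dest!: effective_deg_0)
qed

lemma dominates_1: "dominates D 1 \<longleftrightarrow> (\<forall>w\<in>V. winnable (\<lambda>x. D x - pt w x))"
  unfolding dominates_def by (metis effective_deg_1 effective_pt deg_pt)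

text \<open>The admissible \<open>r\<close> form an initial segment of the nonnegative integers,
  bounded by the degree, so \<open>GREATEST\<close> in \<open>rank\<close> is attained and can be
  traded for \<open>dominates\<close>.\<close>

lemma rank_ge_iff:
  assumes "0 \<le> r" shows "r \<le> rank V m D \<longleftrightarrow> dominates D r"
proof (cases "winnable D")
  case False
  then show ?thesis
    using assms dominates_antimono[of D r 0] dominates_0[of D] by (auto simp: rank_def)
next
  case True
  define X where "X = {r. 0 \<le> r \<and> dominates D r}"
  have "X \<subseteq> {0..deg V D}" using dominates_le_deg by (auto simp: X_def)
  then have "finite X" by (rule finite_subset) simp
  have "X \<noteq> {}" using True dominates_0[of D] unfolding X_def by blast
  have "rank V m D = Max X"
    unfolding rank_def
  proof (simp only: True if_False dominates_def[symmetric], rule Greatest_equality)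
    show "0 \<le> Max X \<and> dominates D (Max X)"
      using Max_in[OF \<open>finite X\<close> \<open>X \<noteq> {}\<close>] unfolding X_def by blast
    show "y \<le> Max X" if "0 \<le> y \<and> dominates D y" for y
      using that \<open>finite X\<close> by (intro Max_ge) (auto simp: X_def)
  qed
  moreover have "r \<le> Max X \<longleftrightarrow> r \<in> X"
  proof
    assume "r \<le> Max X"
    moreover have "0 \<le> Max X" "dominates D (Max X)"
      using Max_in[OF \<open>finite X\<close> \<open>X \<noteq> {}\<close>] unfolding X_def by blast+
    ultimately show "r \<in> X"
      using dominates_antimono[of D "Max X" r] assms unfolding X_def by blast
  qed (use \<open>finite X\<close> in simp)
  ultimately show ?thesis using assms unfolding X_def by simp
qed

lemma rank_not_winnable: "\<not> winnable D \<Longrightarrow> rank V m D = -1"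
  by (simp add: rank_def)

lemma rank_eqI: "0 \<le> r \<Longrightarrow> dominates D r \<Longrightarrow> \<not> dominates D (r + 1) \<Longrightarrow> rank V m D = r"
  using rank_ge_iff[of r D] rank_ge_iff[of "r + 1" D] by linarith

lemma rank_deg_neg: "deg V D < 0 \<Longrightarrow> rank V m D = -1"
  using winnable_deg rank_not_winnable by fastforce

lemma rank_deg_0:
  assumes "deg V D = 0" shows "rank V m D = (if D \<sim> (\<lambda>x. 0) then 0 else -1)"
proof (cases "D \<sim> (\<lambda>x. 0)")
  case True
  then have "dominates D 0" using assms dominates_0 winnable_deg_0 by blast
  moreover have "\<not> dominates D (0 + 1)" using dominates_le_deg[of D 1] assms by auto
  ultimately show ?thesis using True rank_eqI[of 0 D] by simp
next
  case False
  then have "\<not> winnable D" using winnable_deg_0[OF assms] by simp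
  then show ?thesis using False by (simp add: rank_not_winnable del: not_not)
qed

end

section \<open>Crossing patterns\<close>

text \<open>The rank of \<open>D\<^sub>n + j u\<close>, where \<open>S n\<close>, \<open>P n\<close>, \<open>Q n\<close> stand for: \<open>D\<^sub>n\<close> is winnable,
  \<open>D\<^sub>n \<sim> K - u\<close>, \<open>D\<^sub>n \<sim> v\<close>.\<close>

definition pattern_rank ::
  "(int \<Rightarrow> bool) \<Rightarrow> (int \<Rightarrow> bool) \<Rightarrow> (int \<Rightarrow> bool) \<Rightarrow> int \<Rightarrow> int \<Rightarrow> int" where
  "pattern_rank S P Q n j = (if j \<le> -2 then -1 else if j = -1 then of_bool (Q (n - 1)) - 1
     else if j = 0 then of_bool (S n) - 1 else if j = 1 then of_bool (P n) else j - 1)"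

text \<open>The combinatorial residue of submodularity and rigidity, supplied by
  \<open>slice_pattern\<close>. All facts below follow from it by inspecting a few consecutive
  indices.\<close>

locale crossing_pattern =
  fixes S P Q :: "int \<Rightarrow> bool"
  assumes P_S: "P n \<Longrightarrow> S n \<and> S (n + 1)"
    and Q_S: "Q n \<Longrightarrow> S n \<and> S (n + 1)"
    and S_S: "S n \<Longrightarrow> S (n + 1) \<Longrightarrow> P n \<or> Q n"
    and P_Q: "P n \<Longrightarrow> \<not> Q n"
    and P_P: "P n \<Longrightarrow> \<not> P (n + 1)"
    and Q_Q: "Q n \<Longrightarrow> \<not> Q (n + 1)"
begin

text \<open>The five displacements 2, 1, -2, -1, 0 correspond to \<open>j\<close> = 3, 2, -1, 0, 1
  in \<open>pattern_rank_mixed_difference\<close>; the case split picks the \<open>j\<close> at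
  which the mixed difference is 1.\<close>

definition perm :: "int \<Rightarrow> int" where
  "perm b = (if P (b + 1) then b + 2 else if S (b + 1) \<and> \<not> P b then b + 1
     else if Q (b - 1) then b - 2 else if S b \<and> \<not> Q b then b - 1 else b)"

definition perm_inv :: "int \<Rightarrow> int" where
  "perm_inv a = (if P (a - 1) then a - 2 else if S a \<and> \<not> P a then a - 1
     else if Q (a + 1) then a + 2 else if S (a + 1) \<and> \<not> Q a then a + 1 else a)"

text \<open>For \<open>S n\<close>, the unique \<open>a < n\<close> sent to \<open>n\<close> or above, and the unique \<open>b \<ge> n\<close> sent below \<open>n\<close>.\<close>

definition inversion_at :: "int \<Rightarrow> int \<times> int" where
  "inversion_at n = (n - 1 - of_bool (P (n - 1)), n + of_bool (Q n))"

lemma pattern: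
  "(P n \<or> Q n \<longleftrightarrow> S n \<and> S (n + 1)) \<and> \<not> (P n \<and> Q n) \<and> \<not> (P n \<and> P (n + 1)) \<and> \<not> (Q n \<and> Q (n + 1))"
  using P_S Q_S S_S P_Q P_P Q_Q by blast

text \<open>By \<open>Delta_twist\<close> the left side is \<open>Delta\<close> of a twist, so this
  identifies the transmission permutation. For \<open>j\<close> below -1 or above 3 all four ranks
  are given by a single linear formula and cancel.\<close>

lemma pattern_rank_mixed_difference:
  "pattern_rank S P Q b j - pattern_rank S P Q b (j - 1) - pattern_rank S P Q (b + 1) (j - 1)
    + pattern_rank S P Q (b + 1) (j - 2) = of_bool (perm b = b + j - 1)"
proof -
  consider "j \<le> -2" | "j = -1" | "j = 0" | "j = 1" | "j = 2" | "j = 3" | "4 \<le> j" by linarith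
  then show ?thesis
    using pattern[of b] pattern[of "b - 1"] pattern[of "b + 1"]
    by cases (simp_all add: pattern_rank_def perm_def add.commute, argo+)
qed

lemma bij_perm: "bij perm"
proof (rule o_bij)
  have "perm_inv (perm b) = b" for b
    using pattern[of b] pattern[of "b - 1"] pattern[of "b + 1"] pattern[of "b - 2"] pattern[of "b - 3"]
    unfolding perm_def perm_inv_def by (smt (verit))
  then show "perm_inv \<circ> perm = id" by auto
  have "perm (perm_inv a) = a" for a
  proof -
    note patterns = pattern[of a] pattern[of "a - 1"] pattern[of "a + 1"] pattern[of "a + 2"] pattern[of "a + 3"]
    consider "P (a - 1)" "perm_inv a = a - 2"
      | "S a" "\<not> P (a - 1)" "\<not> P a" "perm_inv a = a - 1"
      | "\<not> S a" "\<not> S (a + 1)" "perm_inv a = a"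
      | "S (a + 1)" "\<not> Q a" "\<not> Q (a + 1)" "perm_inv a = a + 1"
      | "Q (a + 1)" "perm_inv a = a + 2"
      using patterns unfolding perm_inv_def by (smt (verit))
    then show ?thesis
      using patterns unfolding perm_def by cases (smt (verit))+
  qed
  then show "perm \<circ> perm_inv = id" by auto
qed

lemma inversion_at_inversion:
  assumes "S n" shows "inversion_at n \<in> inversions perm"
proof -
  have "perm (fst (inversion_at n)) \<ge> n"
    using assms pattern[of "n - 1"] by (auto simp: inversion_at_def perm_def)
  moreover have "perm (snd (inversion_at n)) < n"
  proof (cases "Q n")
    case True
    \<comment> \<open>The second entry is now \<open>n + 1\<close>. It must reach the clause
      \<open>Q (b - 1)\<close> of \<open>perm\<close>, so both earlier clauses have to be
      excluded.\<close>
    have "S (n + 2) \<Longrightarrow> P (n + 1)"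
      using True Q_S[of n] Q_Q[of n] S_S[of "n + 1"] by (simp add: add.commute)
    moreover from this have "\<not> P (n + 2)"
      using P_S[of "n + 2"] P_P[of "n + 1"] by (auto simp: add.commute)
    ultimately show ?thesis using True by (auto simp: inversion_at_def perm_def add.commute)
  next
    case False
    then show ?thesis
      using assms pattern[of n] pattern[of "n + 1"] by (auto simp: inversion_at_def perm_def)
  qed
  moreover have "fst (inversion_at n) < snd (inversion_at n)" by (simp add: inversion_at_def of_bool_def)
  ultimately show ?thesis by (auto simp: inversions_def split: prod.splits)
qed

text \<open>Each entry is displaced by at most one from its standard position, so only consecutive
  indices \<open>x\<close>, \<open>x + 1\<close> could collide; that would force both
  \<open>P x\<close> and \<open>Q x\<close>.\<close>

lemma inj_inversion_at: "inj inversion_at"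
proof (rule linorder_injI)
  fix x y :: int assume "x < y"
  show "inversion_at x \<noteq> inversion_at y"
  proof
    assume *: "inversion_at x = inversion_at y"
    then have "y = x + 1" using \<open>x < y\<close> by (auto simp: inversion_at_def of_bool_def split: if_splits)
    with * show False using P_Q[of x] by (auto simp: inversion_at_def of_bool_def split: if_splits)
  qed
qed

text \<open>Displacements are at most two, so an inversion has gap at most three, and only
  \<open>a + 1\<close> and \<open>a + 2\<close> can be the index sought.\<close>

lemma inversion_cases:
  assumes "a < b" "perm b < perm a"
  shows "\<exists>n. S n \<and> inversion_at n = (a, b)"
proof -
  have "perm a \<le> a + 2" "b - 2 \<le> perm b" by (auto simp: perm_def)
  then consider "b = a + 1" | "b = a + 2" | "b = a + 3" using assms by linarith
  then have "(S (a + 1) \<and> inversion_at (a + 1) = (a, b)) \<or> (S (a + 2) \<and> inversion_at (a + 2) = (a, b))"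
    using assms pattern[of a] pattern[of "a - 1"] pattern[of "a + 1"] pattern[of "a + 2"] pattern[of "a + 3"]
    unfolding inversion_at_def perm_def of_bool_def prod.inject by (smt (verit))
  then show ?thesis by blast
qed

lemma bij_betw_inversion_at: "bij_betw inversion_at {n. S n} (inversions perm)"
  unfolding bij_betw_def
proof (intro conjI equalityI subsetI)
  show "inj_on inversion_at {n. S n}" using inj_inversion_at by (rule inj_on_subset) simp
  show "x \<in> inversions perm" if "x \<in> inversion_at ` {n. S n}" for x
    using that inversion_at_inversion by auto
  show "x \<in> inversion_at ` {n. S n}" if "x \<in> inversions perm" for x
    using that inversion_cases by (auto simp: inversions_def image_iff) metis
qed

text \<open>Under periodicity, adding \<open>i * int k\<close> to \<open>n\<close> translates
  \<open>inversion_at n\<close> by the same amount. Classes of inversions thus correspond to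
  residues of the \<open>n\<close> with \<open>S n\<close>.\<close>

lemma inv_k_perm:
  fixes k :: nat
  assumes "1 \<le> k"
    and S_per: "\<And>n i. S (n + i * int k) = S n"
    and P_per: "\<And>n i. P (n + i * int k) = P n"
    and Q_per: "\<And>n i. Q (n + i * int k) = Q n"
  shows "inv_k k perm = enat (card {n \<in> {0..<int k}. S n})"
proof -
  let ?I = "inversions perm" and ?N = "{n \<in> {0..<int k}. S n}"
  define r where "r = k_equiv k ?I"
  have "trans r"
    unfolding trans_def
  proof (intro allI impI)
    fix x y z assume *: "(x, y) \<in> r" "(y, z) \<in> r"
    then have "int k dvd (fst x - fst y) + (fst y - fst z)"
      by (intro dvd_add) (auto simp: r_def k_equiv_def)
    then have "int k dvd fst x - fst z" by simp
    then show "(x, z) \<in> r" using * by (auto simp: r_def k_equiv_def)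
  qed
  moreover have "sym r"
    by (rule symI) (auto simp: r_def k_equiv_def dvd_diff_commute)
  moreover have "refl_on ?I r" "r \<subseteq> ?I \<times> ?I"
    by (auto simp: refl_on_def r_def k_equiv_def)
  ultimately have eqv: "equiv ?I r" by (simp add: equiv_def)
  have shift: "inversion_at (n + i * int k) = (fst (inversion_at n) + i * int k, snd (inversion_at n) + i * int k)" for n i
    using P_per[of "n - 1" i] Q_per[of n i] by (simp add: inversion_at_def algebra_simps)
  have mem: "inversion_at n \<in> ?I" if "S n" for n using that by (rule inversion_at_inversion)
  have bij: "bij_betw (\<lambda>n. r `` {inversion_at n}) ?N (?I // r)"
    unfolding bij_betw_def
  proof (intro conjI equalityI subsetI)
    show "inj_on (\<lambda>n. r `` {inversion_at n}) ?N"
    proof (rule inj_onI)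
      fix n n' assume n: "n \<in> ?N" "n' \<in> ?N" "r `` {inversion_at n} = r `` {inversion_at n'}"
      then have "(inversion_at n, inversion_at n') \<in> r"
        using eqv mem eq_equiv_class_iff[OF eqv] by auto
      then have "int k dvd fst (inversion_at n) - fst (inversion_at n')"
        and "snd (inversion_at n) - snd (inversion_at n') = fst (inversion_at n) - fst (inversion_at n')"
        by (auto simp: r_def k_equiv_def)
      then obtain i where "fst (inversion_at n) - fst (inversion_at n') = int k * i"
        and "snd (inversion_at n) - snd (inversion_at n') = int k * i"
        by (metis dvdE)
      then have "inversion_at n = inversion_at (n' + i * int k)"
        unfolding shift by (intro prod_eqI) (auto simp: algebra_simps)
      then have "n = n' + i * int k" using inj_inversion_at by (rule injD[rotated])
      then have "n mod int k = n' mod int k" by simp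
      then show "n = n'" using n(1,2) by simp
    qed
    show "C \<in> ?I // r" if "C \<in> (\<lambda>n. r `` {inversion_at n}) ` ?N" for C
      using that mem by (auto intro: quotientI)
    show "C \<in> (\<lambda>n. r `` {inversion_at n}) ` ?N" if C: "C \<in> ?I // r" for C
    proof -
      obtain x where x: "x \<in> ?I" "C = r `` {x}" using C by (rule quotientE)
      then obtain n where n: "S n" "x = inversion_at n"
        using bij_betw_inversion_at by (auto simp: bij_betw_def)
      define n0 where "n0 = n mod int k"
      have n0: "n = n0 + (n div int k) * int k" by (simp add: n0_def)
      then have "S n0" using S_per n(1) by metis
      have "x = (fst (inversion_at n0) + (n div int k) * int k, snd (inversion_at n0) + (n div int k) * int k)"
        using n(2) n0 shift by metis
      then have "(x, inversion_at n0) \<in> r"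
        using x(1) mem[OF \<open>S n0\<close>] by (auto simp: r_def k_equiv_def split: prod.splits)
      then have "C = r `` {inversion_at n0}" using x(2) equiv_class_eq[OF eqv] by blast
      moreover have "n0 \<in> ?N" using assms(1) \<open>S n0\<close> by (simp add: n0_def)
      ultimately show ?thesis by blast
    qed
  qed
  have "finite ?N" by (rule finite_subset[of _ "{0..<int k}"]) auto
  then have "finite (?I // r)" "card (?I // r) = card ?N"
    using bij_betw_finite[OF bij] bij_betw_same_card[OF bij] by simp_all
  then show ?thesis by (simp add: inv_k_def Let_def r_def)
qed

end


section \<open>Rigidly marked graphs of genus two\<close>

locale rigid_genus_two = multigraph V m for V :: "'a set" and m +
  fixes u v :: 'a
  assumes u: "u \<in> V" and v: "v \<in> V"
    and genus: "genus V m = 2"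
    and rigid: "rigidly_marked V m u v"
begin

lemma Delta_nonneg: "D \<in> divisors V \<Longrightarrow> 0 \<le> Delta V m u v D"
proof -
  assume "D \<in> divisors V"
  then have "0 \<le> Delta V m u v (twist u v D 0 0)"
    using rigid by (simp only: rigidly_marked_def submodular_def)
  then show ?thesis by (simp add: twist_def)
qed

text \<open>If \<open>u\<close> and \<open>v\<close> were equivalent, submodularity at the divisor \<open>u\<close> would make all vertices
  equivalent, so that \<open>u + v\<close> would have positive rank.\<close>

lemma marks_not_equiv: "\<not> pt u \<sim> pt v"
proof
  assume uv: "pt u \<sim> pt v"
  have "0 \<le> Delta V m u v (pt u)" using Delta_nonneg pt_divisor u by blast
  moreover have "rank V m (twist u v (pt u) (-1) 0) = 0"
    using lin_equiv_refl[of "\<lambda>x. 0"] u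
    by (subst rank_deg_0) (auto simp: twist_def deg_def)
  moreover have "twist u v (pt u) 0 (-1) \<sim> (\<lambda>x. 0)"
    by (rule lin_equiv_diff_cong[OF uv]) (simp add: twist_def)
  then have "rank V m (twist u v (pt u) 0 (-1)) = 0"
    using u v by (subst rank_deg_0) (auto simp: twist_def deg_simps)
  moreover have "rank V m (twist u v (pt u) (-1) (-1)) = -1"
    using u v by (intro rank_deg_neg) (simp add: twist_def, simp add: deg_def pt_def finite_V sum_negf)
  ultimately have "1 \<le> rank V m (pt u)" by (simp add: Delta_def)
  then have *: "winnable (\<lambda>x. pt u x - pt w x)" if "w \<in> V" for w
    using that rank_ge_iff[of 1 "pt u"] dominates_1[of "pt u"] by auto
  have "winnable (\<lambda>x. pt u x + pt v x - pt w x)" if "w \<in> V" for w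
    using winnable_add[OF *[OF that] winnable_effective[OF effective_pt[OF v]]]
    by (simp add: algebra_simps)
  then have "1 \<le> rank V m (\<lambda>x. pt u x + pt v x)"
    using rank_ge_iff[of 1] dominates_1 by auto
  then show False using rigid by (simp add: rigidly_marked_def)
qed

section \<open>Ranks of all divisors in genus two\<close>

lemma winnable_canonical_minus_pt:
  assumes "w \<in> V" shows "winnable (\<lambda>x. canonical x - pt w x)"
proof (rule winnable_residual)
  show "(\<lambda>x. canonical x - pt w x) \<in> divisors V"
    using canonical_divisor assms by (intro divisors_intros)
  show "deg V (\<lambda>x. canonical x - pt w x) = genus V m - 1"
    using assms by (simp add: genus deg_simps deg_canonical)
  show "winnable (\<lambda>x. canonical x - (canonical x - pt w x))"
    using assms by (simp add: winnable_effective effective_pt)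
qed

text \<open>If every \<open>D - w\<close> is winnable, then so is its residual
  \<open>K - D + w\<close>, with \<open>K\<close> the canonical divisor. As this holds for all
  \<open>w\<close>, \<open>K - D\<close> itself is winnable; having degree 0, it is trivial.\<close>

lemma dominates_1_iff_canonical:
  assumes "D \<in> divisors V" "deg V D = 2"
  shows "dominates D 1 \<longleftrightarrow> D \<sim> canonical"
proof
  assume D: "D \<sim> canonical"
  have "(\<lambda>x. canonical x - pt w x) \<sim> (\<lambda>x. D x - pt w x)" for w
    by (rule lin_equiv_diff_cong[OF lin_equiv_sym[OF D]]) simp
  then show "dominates D 1"
    unfolding dominates_1 using winnable_canonical_minus_pt winnable_cong by blast
next
  assume D: "dominates D 1"
  let ?F = "\<lambda>x. canonical x - D x"
  have "winnable (\<lambda>x. ?F x + pt w x)" if "w \<in> V" for w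
  proof (rule winnable_residual)
    show "(\<lambda>x. ?F x + pt w x) \<in> divisors V"
      using assms(1) canonical_divisor that by (intro divisors_intros)
    show "winnable (\<lambda>x. canonical x - (?F x + pt w x))"
      using D that unfolding dominates_1 by (simp add: algebra_simps)
  qed (use assms(2) that in \<open>simp add: deg_simps deg_canonical genus\<close>)
  moreover have "?F \<in> divisors V" using assms(1) canonical_divisor by (rule divisors_diff[rotated])
  moreover have "deg V ?F = genus V m - 2" using assms(2) by (simp add: genus deg_simps deg_canonical)
  ultimately have "winnable ?F" using winnable_if_translates_winnable by blast
  then have "?F \<sim> (\<lambda>x. 0)"
    using assms(2) by (subst (asm) winnable_deg_0) (auto simp: deg_simps deg_canonical genus)
  then have "canonical \<sim> D" by (rule lin_equiv_diff_cong) simp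
  then show "D \<sim> canonical" by (rule lin_equiv_sym)
qed

lemma canonical_not_marks: "\<not> (\<lambda>x. pt u x + pt v x) \<sim> canonical"
proof
  assume "(\<lambda>x. pt u x + pt v x) \<sim> canonical"
  then have "dominates (\<lambda>x. pt u x + pt v x) 1"
    using u v by (subst dominates_1_iff_canonical) (auto intro: divisors_intros simp: deg_simps)
  then have "1 \<le> rank V m (\<lambda>x. pt u x + pt v x)" using rank_ge_iff[of 1] by auto
  then show False using rigid by (simp add: rigidly_marked_def)
qed

text \<open>Here and in higher degree, a larger rank would put \<open>w\<close> in a class
  independent of \<open>w\<close>, making \<open>u\<close> and \<open>v\<close> equivalent.\<close>

lemma rank_deg_1:
  assumes "D \<in> divisors V" "deg V D = 1"
  shows "rank V m D = (if winnable D then 0 else -1)"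
proof (cases "winnable D")
  case True
  have "\<not> dominates D (0 + 1)"
  proof
    assume "dominates D (0 + 1)"
    then have w: "(\<lambda>x. D x - pt w x) \<sim> (\<lambda>x. 0)" if "w \<in> V" for w
      using that assms(2) winnable_deg_0[of "\<lambda>x. D x - pt w x"] dominates_1[of D]
      by (simp add: deg_simps)
    have "pt u \<sim> pt v"
      by (rule lin_equiv_diff_cong[OF lin_equiv_trans[OF w[OF v] lin_equiv_sym[OF w[OF u]]]]) simp
    then show False using marks_not_equiv by simp
  qed
  then show ?thesis using True rank_eqI[of 0 D] dominates_0[of D] by auto
qed (simp add: rank_not_winnable)

lemma rank_deg_ge_3:
  assumes D: "D \<in> divisors V" and "3 \<le> deg V D"
  shows "rank V m D = deg V D - 2"
proof (rule rank_eqI)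
  show "dominates D (deg V D - 2)"
    unfolding dominates_def
  proof (intro allI impI)
    fix E assume "effective V E \<and> deg V E = deg V D - 2"
    then show "winnable (\<lambda>x. D x - E x)"
      using D by (intro winnable_if_deg_ge_genus divisors_diff) (auto simp: deg_diff genus effective_divisor)
  qed
  show "\<not> dominates D (deg V D - 2 + 1)"
  proof
    assume dom: "dominates D (deg V D - 2 + 1)"
    \<comment> \<open>Removing \<open>d\<close> copies of \<open>u\<close> and one \<open>w\<close>
      leaves degree two and still dominates degree one, so the result is canonical for every
      \<open>w\<close>.\<close>
    define d where "d = deg V D - 3"
    have eq: "(\<lambda>x. D x - d * pt u x - pt w x) \<sim> canonical" if w: "w \<in> V" for w
    proof -
      have "winnable (\<lambda>x. D x - d * pt u x - pt w x - pt z x)" if "z \<in> V" for z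
      proof -
        have "effective V (\<lambda>x. (d * pt u x + pt w x) + pt z x)"
          using u w that assms(2) by (intro effective_add effective_scale effective_pt) (auto simp: d_def)
        moreover have "deg V (\<lambda>x. (d * pt u x + pt w x) + pt z x) = deg V D - 2 + 1"
          using u w that by (simp add: deg_simps d_def)
        ultimately have "winnable (\<lambda>x. D x - ((d * pt u x + pt w x) + pt z x))"
          by (rule dominatesD[OF dom])
        then show ?thesis by (simp add: algebra_simps)
      qed
      then have "dominates (\<lambda>x. D x - d * pt u x - pt w x) 1" unfolding dominates_1 by blast
      moreover have "(\<lambda>x. D x - d * pt u x - pt w x) \<in> divisors V"
        using D u w by (intro divisors_intros)
      ultimately show ?thesis
        using u w by (subst (asm) dominates_1_iff_canonical) (auto simp: deg_simps d_def)
    qed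
    have "pt u \<sim> pt v"
      by (rule lin_equiv_diff_cong[OF lin_equiv_trans[OF eq[OF v] lin_equiv_sym[OF eq[OF u]]]]) simp
    then show False using marks_not_equiv by simp
  qed
qed (use assms in simp)

lemma rank_deg_2:
  assumes D: "D \<in> divisors V" and "deg V D = 2"
  shows "rank V m D = (if D \<sim> canonical then 1 else 0)"
proof -
  have "winnable D" using assms winnable_if_deg_ge_genus genus by simp
  have "\<not> dominates D (1 + 1)"
  proof
    assume dom: "dominates D (1 + 1)"
    have eq: "(\<lambda>x. D x - pt u x - pt w x) \<sim> (\<lambda>x. 0)" if w: "w \<in> V" for w
    proof -
      have "winnable (\<lambda>x. D x - (pt u x + pt w x))"
        using effective_add[OF effective_pt[OF u] effective_pt[OF w]]
        by (rule dominatesD[OF dom]) (simp add: deg_simps u w)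
      then have "winnable (\<lambda>x. D x - pt u x - pt w x)" by (simp add: algebra_simps)
      then show ?thesis
        using assms(2) u w by (subst (asm) winnable_deg_0) (auto simp: deg_simps)
    qed
    have "pt u \<sim> pt v"
      by (rule lin_equiv_diff_cong[OF lin_equiv_trans[OF eq[OF v] lin_equiv_sym[OF eq[OF u]]]]) simp
    then show False using marks_not_equiv by simp
  qed
  then show ?thesis
    using rank_eqI[of 1 D] rank_eqI[of 0 D] dominates_1_iff_canonical[OF assms]
      dominates_0[of D] \<open>winnable D\<close> by auto
qed

section \<open>Twists organized into slices of degree one\<close>

definition slice :: "('a \<Rightarrow> int) \<Rightarrow> int \<Rightarrow> 'a \<Rightarrow> int" where
  "slice D n = (\<lambda>x. D x + (n + 1 - deg V D) * pt u x - n * pt v x)"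

definition slice_winnable where
  "slice_winnable D n \<longleftrightarrow> winnable (slice D n)"

definition slice_canonical where
  "slice_canonical D n \<longleftrightarrow> (\<lambda>x. slice D n x + pt u x) \<sim> canonical"

definition slice_mark where
  "slice_mark D n \<longleftrightarrow> slice D n \<sim> pt v"

lemmas slice_predicates = slice_winnable_def slice_canonical_def slice_mark_def

definition slice_rank where
  "slice_rank D = pattern_rank (slice_winnable D) (slice_canonical D) (slice_mark D)"

lemma slice_divisor: "D \<in> divisors V \<Longrightarrow> slice D n \<in> divisors V"
  unfolding slice_def using u v by (intro divisors_intros)

lemma deg_slice: "deg V (slice D n) = 1"
  using u v by (simp add: slice_def deg_simps)

lemma slice_step: "slice D (n + 1) x = slice D n x + pt u x - pt v x"
  by (simp add: slice_def algebra_simps)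

lemma rank_slice:
  assumes "D \<in> divisors V"
  shows "rank V m (\<lambda>x. slice D n x + j * pt u x) = slice_rank D n j"
proof -
  let ?E = "\<lambda>x. slice D n x + j * pt u x"
  have E: "?E \<in> divisors V" using slice_divisor[OF assms] u by (intro divisors_intros)
  have deg: "deg V ?E = 1 + j" using u by (simp add: deg_simps deg_slice)
  consider "j \<le> -2" | "j = -1" | "j = 0" | "j = 1" | "2 \<le> j" by linarith
  then show ?thesis
  proof cases
    case 1
    then show ?thesis using deg rank_deg_neg[of ?E] by (simp add: slice_rank_def pattern_rank_def slice_predicates)
  next
    case 2
    \<comment> \<open>In degree 0 the divisor \<open>slice D n - u\<close> is the same as
      \<open>slice D (n - 1) - v\<close>; hence the shifted index in
      \<open>pattern_rank\<close>.\<close>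
    have "?E \<sim> (\<lambda>x. 0) \<longleftrightarrow> slice_mark D (n - 1)"
      unfolding slice_mark_def
      by (rule iffI; erule lin_equiv_diff_cong; simp add: 2 slice_step[of D "n - 1", simplified])
    then show ?thesis using 2 deg rank_deg_0[of ?E] by (simp add: slice_rank_def pattern_rank_def slice_predicates)
  next
    case 3
    then show ?thesis using E deg rank_deg_1[of ?E] by (simp add: slice_rank_def pattern_rank_def slice_predicates)
  next
    case 4
    then show ?thesis using E deg rank_deg_2[of ?E] by (simp add: slice_rank_def pattern_rank_def slice_predicates)
  next
    case 5
    then show ?thesis using E deg rank_deg_ge_3[of ?E] by (simp add: slice_rank_def pattern_rank_def slice_predicates)
  qed
qed

text \<open>\<open>D + a u - b v\<close> has degree \<open>j + 1\<close> and equals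
  \<open>slice D b + j u\<close>. Removing \<open>u\<close> lowers \<open>j\<close>; removing
  \<open>v\<close> also lowers \<open>j\<close> but passes to the next slice.\<close>

lemma Delta_twist:
  assumes "D \<in> divisors V" and j: "j = a - b - 1 + deg V D"
  shows "Delta V m u v (twist u v D a (- b)) =
    slice_rank D b j - slice_rank D b (j - 1) - slice_rank D (b + 1) (j - 1) + slice_rank D (b + 1) (j - 2)"
proof -
  have "twist u v D a (- b) = (\<lambda>x. slice D b x + j * pt u x)"
    "twist u v (twist u v D a (- b)) (-1) 0 = (\<lambda>x. slice D b x + (j - 1) * pt u x)"
    "twist u v (twist u v D a (- b)) 0 (-1) = (\<lambda>x. slice D (b + 1) x + (j - 1) * pt u x)"
    "twist u v (twist u v D a (- b)) (-1) (-1) = (\<lambda>x. slice D (b + 1) x + (j - 2) * pt u x)"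
    by (auto simp: fun_eq_iff twist_def slice_def j algebra_simps)
  then show ?thesis unfolding Delta_def by (simp only: rank_slice[OF assms(1)])
qed

lemma slice_pattern:
  assumes D: "D \<in> divisors V"
  shows "crossing_pattern (slice_winnable D) (slice_canonical D) (slice_mark D)"
proof
  fix n
  show "slice_winnable D n \<and> slice_winnable D (n + 1)" if P: "slice_canonical D n"
  proof -
    have "slice D n \<sim> (\<lambda>x. canonical x - pt u x)"
      by (rule lin_equiv_diff_cong[OF P[unfolded slice_predicates]]) simp
    moreover have "slice D (n + 1) \<sim> (\<lambda>x. canonical x - pt v x)"
      by (rule lin_equiv_diff_cong[OF P[unfolded slice_predicates]]) (simp add: slice_step)
    ultimately show ?thesis
      unfolding slice_predicates using winnable_canonical_minus_pt u v winnable_cong by blast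
  qed
  show "slice_winnable D n \<and> slice_winnable D (n + 1)" if Q: "slice_mark D n"
  proof -
    have "slice D (n + 1) \<sim> pt u"
      by (rule lin_equiv_diff_cong[OF Q[unfolded slice_predicates]]) (simp add: slice_step)
    then show ?thesis
      using Q u v unfolding slice_predicates using winnable_effective effective_pt winnable_cong by blast
  qed
  show "slice_canonical D n \<or> slice_mark D n" if "slice_winnable D n" "slice_winnable D (n + 1)"
  proof -
    \<comment> \<open>This twist is \<open>slice D n + u\<close>. With both slices winnable, its
      \<open>Delta\<close> is the number of true statements among \<open>slice_canonical D n\<close>
      and \<open>slice_mark D n\<close>, minus one.\<close>
    have "twist u v D (n + 2 - deg V D) (- n) \<in> divisors V"
      unfolding twist_def using D u v by (intro divisors_intros)
    then have "0 \<le> Delta V m u v (twist u v D (n + 2 - deg V D) (- n))" by (rule Delta_nonneg)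
    then show ?thesis
      unfolding Delta_twist[OF D refl] using that by (auto simp: slice_rank_def pattern_rank_def split: if_splits)
  qed
  show "\<not> slice_mark D n" if P: "slice_canonical D n"
  proof
    assume Q: "slice_mark D n"
    have "(\<lambda>x. pt u x + pt v x) \<sim> canonical"
      by (rule lin_equiv_diff_cong[OF lin_equiv_add[OF P[unfolded slice_predicates] lin_equiv_sym[OF Q[unfolded slice_predicates]]]]) simp
    then show False using canonical_not_marks by simp
  qed
  show "\<not> slice_canonical D (n + 1)" if P: "slice_canonical D n"
  proof
    assume "slice_canonical D (n + 1)"
    from lin_equiv_trans[OF this[unfolded slice_predicates] lin_equiv_sym[OF P[unfolded slice_predicates]]] have "pt u \<sim> pt v"
      by (rule lin_equiv_diff_cong) (simp add: slice_step)
    then show False using marks_not_equiv by simp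
  qed
  show "\<not> slice_mark D (n + 1)" if Q: "slice_mark D n"
  proof
    assume "slice_mark D (n + 1)"
    from lin_equiv_trans[OF this[unfolded slice_predicates] lin_equiv_sym[OF Q[unfolded slice_predicates]]] have "pt u \<sim> pt v"
      by (rule lin_equiv_diff_cong) (simp add: slice_step)
    then show False using marks_not_equiv by simp
  qed
qed

lemma inv_k_trans_perm:
  assumes D: "D \<in> divisors V" and k: "torsion_order V m u v k"
  shows "inv_k k (trans_perm V m u v D) = enat (card {n \<in> {0..<int k}. slice_winnable D n})"
proof -
  interpret crossing_pattern "slice_winnable D" "slice_canonical D" "slice_mark D"
    using D by (rule slice_pattern)
  \<comment> \<open>Solving \<open>perm b = b + j - 1\<close> with
    \<open>j = a - b - 1 + deg V D\<close> for \<open>a\<close> gives this shift, which leaves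
    inversions unchanged.\<close>
  let ?\<tau> = "\<lambda>b. perm b + (2 - deg V D)"
  have Delta: "Delta V m u v (twist u v D a (- b)) = (if ?\<tau> b = a then 1 else 0)" for a b
    unfolding Delta_twist[OF D refl] slice_rank_def pattern_rank_mixed_difference
    by (auto simp: of_bool_def)
  have "bij ((\<lambda>a. a + (2 - deg V D)) \<circ> perm)"
    using bij_perm by (rule bij_comp) (rule bij_plus_right)
  then have "bij ?\<tau>" by (simp add: comp_def)
  have "trans_perm V m u v D = ?\<tau>"
    unfolding trans_perm_def Delta
  proof (rule the_equality)
    show "bij ?\<tau> \<and> (\<forall>a b. (if ?\<tau> b = a then 1 else 0 :: int) = (if ?\<tau> b = a then 1 else 0))"
      using \<open>bij ?\<tau>\<close> by blast
    fix \<tau> :: "int \<Rightarrow> int"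
    assume "bij \<tau> \<and> (\<forall>a b. (if \<tau> b = a then 1 else 0 :: int) = (if ?\<tau> b = a then 1 else 0))"
    then show "\<tau> = ?\<tau>" by (intro ext) (metis zero_neq_one)
  qed
  then have inv_eq: "inv_k k (trans_perm V m u v D) = inv_k k perm"
    by (simp add: inv_k_def inversions_def)
  have kuv: "(\<lambda>x. int k * pt u x) \<sim> (\<lambda>x. int k * pt v x)" and "1 \<le> k"
    using k by (auto simp: torsion_order_def)
  have period: "slice D (n + i * int k) \<sim> slice D n" for n i
    by (rule lin_equiv_diff_cong[OF lin_equiv_scale[OF kuv, of i]])
       (simp add: slice_def algebra_simps)
  have "inv_k k perm = enat (card {n \<in> {0..<int k}. slice_winnable D n})"
  proof (rule inv_k_perm[OF \<open>1 \<le> k\<close>])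
    fix n i
    show "slice_winnable D (n + i * int k) = slice_winnable D n"
      unfolding slice_predicates using winnable_cong[OF period] .
    show "slice_mark D (n + i * int k) = slice_mark D n"
      unfolding slice_predicates using period[of n i] lin_equiv_trans lin_equiv_sym by blast
    show "slice_canonical D (n + i * int k) = slice_canonical D n"
      unfolding slice_predicates
      using lin_equiv_add[OF period[of n i] lin_equiv_refl[of "pt u"]] lin_equiv_trans lin_equiv_sym
      by blast
  qed
  then show ?thesis using inv_eq by simp
qed

section \<open>Comparison with non-recurrence\<close>

lemma class_order_marks:
  assumes "torsion_order V m u v k"
  shows "class_order V m (\<lambda>x. pt u x - pt v x) = k"
proof -
  have *: "(\<lambda>x. int j * (pt u x - pt v x)) \<sim> (\<lambda>x. 0) \<longleftrightarrow>
      (\<lambda>x. int j * pt u x) \<sim> (\<lambda>x. int j * pt v x)" for j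
    by (rule iffI; erule lin_equiv_diff_cong; simp add: algebra_simps)
  show ?thesis
    unfolding class_order_def *
    using assms by (intro Least_equality) (auto simp: torsion_order_def intro: leI)
qed

theorem general_transmission_iff_non_recurrent:
  assumes k: "torsion_order V m u v k"
  shows "k_general_transmission V m u v k \<longleftrightarrow> non_recurrent V m (\<lambda>x. pt u x - pt v x)"
proof -
  let ?N = "\<lambda>D. {n \<in> {0..<int k}. winnable (slice D n)}"
  let ?M = "\<lambda>w. {n :: nat. 1 \<le> n \<and> n < k \<and> winnable (\<lambda>x. int n * (pt u x - pt v x) + pt w x)}"
  have general: "k_general_transmission V m u v k \<longleftrightarrow> (\<forall>D\<in>divisors V. card (?N D) \<le> 2)"
    using k rigid by (auto simp: k_general_transmission_def torsion_order_def rigidly_marked_def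
        inv_k_trans_perm[OF _ k] genus slice_winnable_def)
  have non_rec: "non_recurrent V m (\<lambda>x. pt u x - pt v x) \<longleftrightarrow> (\<forall>w\<in>V. card (?M w) \<le> 1)"
    by (simp add: non_recurrent_def class_order_marks[OF k])
  have k1: "1 \<le> k" using k by (simp add: torsion_order_def)
  have fin_N: "finite (?N D)" for D by (rule finite_subset[of _ "{0..<int k}"]) auto
  show ?thesis
    unfolding general non_rec
  proof (intro iffI ballI)
    fix w assume w: "w \<in> V" and le: "\<forall>D\<in>divisors V. card (?N D) \<le> 2"
    \<comment> \<open>Chosen so that slice 0 is \<open>w\<close> itself: index 0 is always winnable,
      and the indices from 1 to \<open>k - 1\<close> are those tested by non-recurrence at
      \<open>w\<close>.\<close>
    define D where "D x = pt w x + pt u x" for x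
    have "D \<in> divisors V" unfolding D_def using w u by (intro divisors_intros)
    then have "card (?N D) \<le> 2" using le by blast
    have "deg V D = 2" unfolding D_def using w u by (simp add: deg_simps)
    then have slice: "slice D n = (\<lambda>x. n * (pt u x - pt v x) + pt w x)" for n
      by (auto simp: slice_def D_def algebra_simps)
    have "0 \<in> ?N D" using k1 w by (simp add: slice winnable_effective effective_pt)
    then have "card (?N D - {0}) \<le> 1" using \<open>card (?N D) \<le> 2\<close> by (simp only: card_Diff_singleton)
    moreover have "int ` ?M w \<subseteq> ?N D - {0}" by (auto simp: slice)
    then have "card (?M w) \<le> card (?N D - {0})" using fin_N[of D] by (intro card_inj_on_le) auto
    ultimately show "card (?M w) \<le> 1" by simp
  next
    fix D assume le: "\<forall>w\<in>V. card (?M w) \<le> 1" and D: "D \<in> divisors V"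
    show "card (?N D) \<le> 2"
    proof (cases "?N D = {}")
      case False
      then obtain l where l: "l \<in> ?N D" by blast
      then obtain w where w: "w \<in> V" "slice D l \<sim> pt w"
        using winnable_deg_1[OF deg_slice] by auto
      have kuv: "(\<lambda>x. int k * pt u x) \<sim> (\<lambda>x. int k * pt v x)"
        using k by (simp add: torsion_order_def)
      \<comment> \<open>Measure indices modulo \<open>k\<close> from the winnable index
        \<open>l\<close>. Then \<open>l\<close> goes to 0, which \<open>?M w\<close> excludes, and
        this accounts for the gap between the bounds 2 and 1.\<close>
      define f where "f n = nat ((n - l) mod int k)" for n
      have f: "int (f n) = (n - l) mod int k" for n using k1 by (simp add: f_def)
      have inj: "inj_on f (?N D)"
      proof (rule inj_onI)
        fix n n' assume n: "n \<in> ?N D" "n' \<in> ?N D" "f n = f n'"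
        then have "(n - l) mod int k = (n' - l) mod int k" by (metis f)
        then have "(n - l + l) mod int k = (n' - l + l) mod int k" by (metis mod_add_left_eq)
        then show "n = n'" using n by simp
      qed
      have "f ` (?N D - {l}) \<subseteq> ?M w"
      proof
        fix j assume "j \<in> f ` (?N D - {l})"
        then obtain n where n: "n \<in> ?N D" "n \<noteq> l" "j = f n" by auto
        have "f l = 0" by (simp add: f_def)
        then have "j \<noteq> 0" using inj_onD[OF inj _ n(1) l] n(2,3) by auto
        moreover have "j < k" using f[of n] n(3) k1 by (metis of_nat_less_iff pos_mod_bound of_nat_0_less_iff less_le_trans zero_less_one)
        moreover have "winnable (\<lambda>x. int j * (pt u x - pt v x) + pt w x)"
        proof -
          have j: "int j = (n - l) - ((n - l) div int k) * int k"
            using f[of n] n(3) by (simp add: minus_div_mult_eq_mod)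
          \<comment> \<open>\<open>slice D n\<close> is \<open>slice D l + (n - l) (u - v)\<close>;
            replace \<open>slice D l\<close> by \<open>w\<close> and discard the multiple of
            \<open>k (u - v)\<close>, which is trivial.\<close>
          have "slice D n \<sim> (\<lambda>x. int j * (pt u x - pt v x) + pt w x)"
            by (rule lin_equiv_diff_cong[OF lin_equiv_add[OF w(2) lin_equiv_scale[OF kuv, of "(n - l) div int k"]]])
               (simp only: slice_def j, simp add: algebra_simps)
          then show ?thesis using n(1) winnable_cong by auto
        qed
        ultimately show "j \<in> ?M w" by simp
      qed
      moreover have "inj_on f (?N D - {l})" using inj by (rule inj_on_subset) simp
      ultimately have "card (?N D - {l}) \<le> card (?M w)"
        by (intro card_inj_on_le) auto
      then have "card (?N D - {l}) \<le> 1" using le w(1) by fastforce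
      then show ?thesis using l by (simp only: card_Diff_singleton)
    qed (simp only: card.empty)
  qed
qed

end

theorem mainTheorem5:
  fixes V :: "'a set" and m :: "'a \<Rightarrow> 'a \<Rightarrow> nat" and u v :: 'a and k :: nat
  assumes "is_graph V m"
    and "bridgeless V m"
    and "u \<in> V" and "v \<in> V" and "u \<noteq> v"
    and "genus V m = 2"
    and "rigidly_marked V m u v"
    and "torsion_order V m u v k"
  shows "k_general_transmission V m u v k \<longleftrightarrow>
         non_recurrent V m (\<lambda>x. pt u x - pt v x)"
proof -
  interpret rigid_genus_two V m u v
    using assms by unfold_locales auto
  show ?thesis using assms(8) by (rule general_transmission_iff_non_recurrent)
qed

end
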